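(* Let $m$ be a positive integer and $\epsilon>0$. There exists $\beta(m)>0$ such that for all sufficiently large $d$ the following holds: if $p_1,\ldots,p_m\in\mathbb{R}P^2$ satisfy $d_{FS}(p_i,p_j)\geq 2d^{-\frac12+\epsilon}$ for all $i\neq j$, then the probability that the points $p_1,\ldots,p_m$ all lie in different connected components of the complement in $\mathbb{R}P^2$ of a Kostlan random real plane curve of degree $d$ is at least $d^{-\beta(m)}$.
   Context: Let $H_d$ be the complex vector space of homogeneous polynomials of degree $d$ in $X_0,X_1,X_2$, of dimension $N_d=\binom{d+2}{2}$. For $P\in H_d$ the pointwise Fubini-Study norm at $[X]\in\mathbb{C}P^2$ is $\|P\|_{FS}^2=|P(X)|^2/\|X\|^{2d}$; in the affine chart $z=(z_1,z_2)\leftrightarrow[1:z_1:z_2]$ it is $|P(1,z_1,z_2)|^2/(1+\|z\|^2)^d$. The Fubini-Study volume form is $dVol_{FS}=dVol/(1+\|z\|^2)^3$ in this chart ($dVol$ is Lebesgue measure on $\mathbb{C}^2$), so $Vol_{FS}(\mathbb{C}P^2)=\pi^2/2$. The $L^2$-norm is $\|P\|_2^2=\frac{1}{Vol_{FS}(\mathbb{C}P^2)}\int_{\mathbb{C}P^2}\|P(z)\|_{FS}^2\,dVol_{FS}$. A Kostlan random real polynomial of degree $d$ is a random element of the real vector space of real polynomials in $H_d$ with the Gaussian probability measure $\pi^{-N_d/2}e^{-\|P\|_2^2}\,dP$, where $dP$ is Lebesgue measure for the inner product inducing $\|\cdot\|_2$. A Kostlan random real plane curve of degree $d$ is the zero locus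 in $\mathbb{R}P^2$ of a Kostlan random real polynomial of degree $d$. $d_{FS}$ is the Fubini-Study distance, normalized so that $d_{FS}([X],[Y])=\arccos\frac{|\langle X,Y\rangle|}{\|X\|\,\|Y\|}$ (equivalently $\tan d_{FS}(0,z)=\|z\|$ in the affine chart). The number $\beta(m)$ depends only on $m$. *)

theory Defs
  imports "HOL-Probability.Probability"
begin

text \<open>Points of the real projective plane are the classes \<open>proj_pt v\<close> of nonzero vectors \<open>v\<close>;
  the value \<open>proj_pt 0\<close> has no meaning.\<close>

quotient_type rp2 = "real^3" / partial:
  "\<lambda>v w. v \<noteq> 0 \<and> w \<noteq> 0 \<and> (\<exists>c::real. w = c *\<^sub>R v)"
  morphisms rep_pt proj_pt
proof (rule part_equivpI)
  show "\<exists>v::real^3. v \<noteq> 0 \<and> v \<noteq> 0 \<and> (\<exists>c::real. v = c *\<^sub>R v)"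
    by (intro exI[of _ 1] conjI exI[of _ "1::real"]) simp_all
  show "symp (\<lambda>v w::real^3. v \<noteq> 0 \<and> w \<noteq> 0 \<and> (\<exists>c::real. w = c *\<^sub>R v))"
  proof (rule sympI, elim conjE exE, intro conjI)
    fix v w :: "real^3" and c :: real
    assume "w \<noteq> 0" "w = c *\<^sub>R v"
    then have "v = inverse c *\<^sub>R w" by auto
    then show "\<exists>c::real. v = c *\<^sub>R w" ..
  qed
  show "transp (\<lambda>v w::real^3. v \<noteq> 0 \<and> w \<noteq> 0 \<and> (\<exists>c::real. w = c *\<^sub>R v))"
    by (rule transpI) (metis scaleR_scaleR)
qed

text \<open>The topology is the quotient topology of the punctured space.\<close>

instantiation rp2 :: topological_space
begin

definition open_rp2 :: "rp2 set \<Rightarrow> bool" where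
  "open_rp2 U \<longleftrightarrow> open {v. v \<noteq> 0 \<and> proj_pt v \<in> U}"

instance
proof
  show "open (UNIV :: rp2 set)"
  proof -
    have "{v::real^3. v \<noteq> 0 \<and> proj_pt v \<in> UNIV} = - {0}" by auto
    then show ?thesis unfolding open_rp2_def by (simp add: open_Compl)
  qed
next
  fix S T :: "rp2 set"
  assume "open S" "open T"
  moreover have "{v. v \<noteq> 0 \<and> proj_pt v \<in> S \<inter> T}
      = {v. v \<noteq> 0 \<and> proj_pt v \<in> S} \<inter> {v. v \<noteq> 0 \<and> proj_pt v \<in> T}" by auto
  ultimately show "open (S \<inter> T)" unfolding open_rp2_def by auto
next
  fix K :: "rp2 set set"
  assume "\<forall>S\<in>K. open S"
  moreover have "{v. v \<noteq> 0 \<and> proj_pt v \<in> \<Union>K}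
      = (\<Union>S\<in>K. {v. v \<noteq> 0 \<and> proj_pt v \<in> S})" by auto
  ultimately show "open (\<Union>K)" unfolding open_rp2_def by auto
qed

end

lift_definition fs_dist :: "rp2 \<Rightarrow> rp2 \<Rightarrow> real" is
  "\<lambda>v w. arccos (\<bar>v \<bullet> w\<bar> / (norm v * norm w))"
  by (auto simp: abs_mult divide_simps)

text \<open>A real homogeneous polynomial of degree \<open>d\<close> in three variables is given by its coefficient
  family, indexed by the exponents of the monomials of degree \<open>d\<close>; the families are
  \<open>extensional\<close>, so that they form the underlying space of a product measure.\<close>

type_synonym hpoly = "nat \<times> nat \<times> nat \<Rightarrow> real"

definition monoms :: "nat \<Rightarrow> (nat \<times> nat \<times> nat) set" where
  "monoms d = {(i, j, k). i + j + k = d}"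

definition hpolys :: "nat \<Rightarrow> hpoly set" where
  "hpolys d = (\<Pi>\<^sub>E a\<in>monoms d. UNIV)"

definition dim_hpolys :: "nat \<Rightarrow> nat" where
  "dim_hpolys d = (d + 2) choose 2"

definition hpoly_eval :: "nat \<Rightarrow> hpoly \<Rightarrow> 'a::real_normed_field ^ 3 \<Rightarrow> 'a" where
  "hpoly_eval d P X = (\<Sum>(i, j, k)\<in>monoms d. of_real (P (i, j, k)) * X $ 1 ^ i * X $ 2 ^ j * X $ 3 ^ k)"

definition fs_norm_sq :: "nat \<Rightarrow> hpoly \<Rightarrow> complex ^ 3 \<Rightarrow> real" where
  "fs_norm_sq d P X = (cmod (hpoly_eval d P X))\<^sup>2 / norm X ^ (2 * d)"

text \<open>The Fubini-Study volume of the complex projective plane, read in the affine chart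
  \<open>(z1, z2) \<mapsto> [1 : z1 : z2]\<close>, whose complement (a line) is a null set.\<close>

definition fs_volume :: "(complex \<times> complex) measure" where
  "fs_volume = density lborel (\<lambda>z. ennreal (1 / (1 + (norm z)\<^sup>2) ^ 3))"

definition l2_norm_sq :: "nat \<Rightarrow> hpoly \<Rightarrow> real" where
  "l2_norm_sq d P =
     1 / measure fs_volume UNIV * (LINT z|fs_volume. fs_norm_sq d P (vector [1, fst z, snd z]))"

text \<open>By polarization, this is the inner product inducing the \<open>L\<^sup>2\<close> norm.\<close>

definition l2_inner :: "nat \<Rightarrow> hpoly \<Rightarrow> hpoly \<Rightarrow> real" where
  "l2_inner d P Q = (l2_norm_sq d (\<lambda>a\<in>monoms d. P a + Q a) - l2_norm_sq d (\<lambda>a\<in>monoms d. P a - Q a)) / 4"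

text \<open>An orthonormal family of \<open>dim_hpolys d\<close> elements is a basis, since
  \<open>card (monoms d) = dim_hpolys d\<close>.\<close>

definition orthonormal_basis :: "nat \<Rightarrow> (nat \<Rightarrow> hpoly) \<Rightarrow> bool" where
  "orthonormal_basis d b \<longleftrightarrow>
     (\<forall>i<dim_hpolys d. b i \<in> hpolys d) \<and>
     (\<forall>i<dim_hpolys d. \<forall>j<dim_hpolys d. l2_inner d (b i) (b j) = (if i = j then 1 else 0))"

text \<open>The Lebesgue measure of the Euclidean space of real polynomials: the image of Lebesgue measure
  under the linear isometry given by an orthonormal basis. As isometries preserve Lebesgue measure,
  it does not depend on the basis.\<close>

definition lebesgue_hpolys :: "nat \<Rightarrow> hpoly measure" where
  "lebesgue_hpolys d =
     (let b = (SOME b. orthonormal_basis d b) in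
      distr (\<Pi>\<^sub>M i\<in>{..<dim_hpolys d}. lborel) (\<Pi>\<^sub>M a\<in>monoms d. borel)
        (\<lambda>x. \<lambda>a\<in>monoms d. \<Sum>i<dim_hpolys d. x i * b i a))"

definition kostlan :: "nat \<Rightarrow> hpoly measure" where
  "kostlan d = density (lebesgue_hpolys d)
     (\<lambda>P. ennreal (pi powr (- real (dim_hpolys d) / 2) * exp (- l2_norm_sq d P)))"

definition real_curve :: "nat \<Rightarrow> hpoly \<Rightarrow> rp2 set" where
  "real_curve d P = {proj_pt v |v. v \<noteq> 0 \<and> hpoly_eval d P v = 0}"

definition in_different_components :: "'i set \<Rightarrow> ('i \<Rightarrow> 'a::topological_space) \<Rightarrow> 'a set \<Rightarrow> bool" where
  "in_different_components I p S \<longleftrightarrow>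
     (\<exists>C. inj_on C I \<and> (\<forall>i\<in>I. C i \<in> components S \<and> p i \<in> C i))"

end

theory Submission imports Defs begin

text \<open>
A random polynomial is, up to the factor \<open>sqrt N\<close> with \<open>N = dim_hpolys d\<close>, of size about \<open>1\<close> at a given point
of the sphere, and its values at \<open>X\<close> and \<open>Y\<close> have correlation \<open>(X \<bullet> Y)^d\<close>
(\<open>reproducing_kernel\<close>). This correlation is negligible beyond distances of order \<open>1 / sqrt d\<close>, and the given
points are much farther apart. So one can prescribe the behaviour of the polynomial near the points almost
independently of each other. If it is negative at a point and positive on a small circle around it, no
connected subset of the complement that contains the point leaves the disc, so the point is separated from all the others
(\<open>sign_change_separates\<close>).

To produce these signs, an explicit polynomial is added to a typical random one. For each point, four kernels
with peaks on the circle of radius \<open>1 / sqrt d\<close> minus a multiple of the kernel at the centre give a bump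
that is at most \<open>-1/4\<close> at the centre and at least \<open>1/4\<close> on the circle (\<open>tangent_circle_peaks\<close>);
the bumps at different points hardly interact (\<open>inner_near_distant_points\<close>). Their sum, the barrier,
has bounded \<open>L\<^sup>2\<close> norm even after multiplication by \<open>sqrt N\<close>. With probability at least \<open>1/2\<close>
the random polynomial is \<open>O(sqrt (N * ln d))\<close> on all these circles, by a union bound over a net of polynomial
size (\<open>noise_bounded_event\<close>). Hence a multiple of the barrier of size \<open>O(sqrt (N * ln d))\<close> wins over it. By the Cameron-Martin inequality
(\<open>std_gauss_translation\<close>) shifting the Gaussian measure by a vector of squared norm \<open>O(ln d)\<close> that has
inner product \<open>O(ln d)\<close> with the random part costs a factor \<open>exp (- O(ln d))\<close>, which is a power of \<open>d\<close>.
The constants depend only on the number of points.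

Two things have to be supplied for this argument. The Gaussian coordinates require the \<open>L\<^sup>2\<close> inner product to be
known: monomials are orthogonal by rotation invariance and their norms are Dirichlet integrals
(\<open>l2_norm_sq_eq\<close>). And the event must be measurable (\<open>measurable_in_different_components\<close>), which holds
because the polynomials whose zero set does not separate two given points form an open set.
\<close>

section \<open>Radial integrals over the complex plane\<close>

lemma nn_integral_power_exp:
  fixes c :: real assumes "c > 0"
  shows "(\<integral>\<^sup>+x. ennreal (x ^ n * exp (- c * x)) * indicator {0..} x \<partial>lborel) = ennreal (fact n / c ^ (n + 1))"
proof -
  have "(\<integral>\<^sup>+x. ennreal (x ^ n * exp (- c * x)) * indicator {0..} x \<partial>lborel)
     = (\<integral>\<^sup>+x. ennreal (1 / c) * ennreal (erlang_density 0 c x * x ^ n) \<partial>lborel)"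
    using assms by (intro nn_integral_cong)
      (auto simp: erlang_density_def indicator_def ennreal_mult'[symmetric] field_simps)
  also have "\<dots> = ennreal (1 / c) * ennreal (fact n / c ^ n)"
    using assms nn_integral_erlang_ith_moment[OF assms, of 0 n]
    by (subst nn_integral_cmult) auto
  also have "\<dots> = ennreal (fact n / c ^ (n + 1))"
    using assms by (subst ennreal_mult[symmetric]) (auto simp: field_simps)
  finally show ?thesis .
qed

text \<open>The power of \<open>c + s\<close> is a Laplace transform:
\<open>n! / (c + s)^(n+1)\<close> is the integral of \<open>x^n * exp (- (c + s) * x)\<close> over the positive half-line. After exchanging the two
integrals, both are moments of exponential distributions.\<close>

lemma nn_integral_beta_prime:
  fixes c :: real assumes c: "c > 0" and jn: "j < n"
  shows "(\<integral>\<^sup>+s. ennreal (s ^ j / (c + s) ^ (n + 1)) * indicator {0..} s \<partial>lborel)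
    = ennreal (fact j * fact (n - j - 1) / (fact n * c ^ (n - j)))"
proof -
  let ?f = "\<lambda>s x::real. ennreal (s ^ j * exp (- x * s)) * indicator {0..} s * (ennreal (x ^ n * exp (- c * x)) * indicator {0<..} x)"
  have nz: "(\<integral>\<^sup>+x. ennreal (x ^ n * exp (- c * x)) * indicator {0<..} x \<partial>lborel) = ennreal (fact n / c ^ (n + 1))"
    if "c > 0" for n and c :: real
  proof -
    have "(\<integral>\<^sup>+x. ennreal (x ^ n * exp (- c * x)) * indicator {0<..} x \<partial>lborel)
      = (\<integral>\<^sup>+x. ennreal (x ^ n * exp (- c * x)) * indicator {0..} x \<partial>lborel)"
      by (intro nn_integral_cong_AE AE_I[where N="{0}"]) (auto simp: indicator_def)
    then show ?thesis using nn_integral_power_exp[OF that] by simp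
  qed
  have "(\<integral>\<^sup>+s. (\<integral>\<^sup>+x. ?f s x \<partial>lborel) \<partial>lborel) = (\<integral>\<^sup>+s. ennreal (fact n) * (ennreal (s ^ j / (c + s) ^ (n + 1)) * indicator {0..} s) \<partial>lborel)"
  proof (intro nn_integral_cong)
    fix s :: real
    show "(\<integral>\<^sup>+x. ?f s x \<partial>lborel) = ennreal (fact n) * (ennreal (s ^ j / (c + s) ^ (n + 1)) * indicator {0..} s)"
    proof (cases "s \<ge> 0")
      case True
      have "(\<integral>\<^sup>+x. ?f s x \<partial>lborel) = (\<integral>\<^sup>+x. ennreal (s ^ j) * (ennreal (x ^ n * exp (- (c + s) * x)) * indicator {0<..} x) \<partial>lborel)"
        using True by (intro nn_integral_cong)
          (auto simp: indicator_def ennreal_mult'[symmetric] exp_add[symmetric] algebra_simps)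
      also have "\<dots> = ennreal (s ^ j) * ennreal (fact n / (c + s) ^ (n + 1))"
        using True c nz[of "c + s" n] by (subst nn_integral_cmult) auto
      finally show ?thesis using True c by (auto simp: ennreal_mult[symmetric] field_simps)
    qed auto
  qed
  also have "\<dots> = ennreal (fact n) * (\<integral>\<^sup>+s. (ennreal (s ^ j / (c + s) ^ (n + 1)) * indicator {0..} s) \<partial>lborel)"
    by (subst nn_integral_cmult) auto
  finally have 1: "(\<integral>\<^sup>+s. (\<integral>\<^sup>+x. ?f s x \<partial>lborel) \<partial>lborel) = \<dots>" .
  have "(\<integral>\<^sup>+s. (\<integral>\<^sup>+x. ?f s x \<partial>lborel) \<partial>lborel) = (\<integral>\<^sup>+x. (\<integral>\<^sup>+s. ?f s x \<partial>lborel) \<partial>lborel)"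
    by (rule lborel_pair.Fubini') measurable
  also have "\<dots> = (\<integral>\<^sup>+x. ennreal (fact j) * (ennreal (x ^ (n - j - 1) * exp (- c * x)) * indicator {0<..} x) \<partial>lborel)"
  proof (intro nn_integral_cong)
    fix x :: real
    show "(\<integral>\<^sup>+s. ?f s x \<partial>lborel) = ennreal (fact j) * (ennreal (x ^ (n - j - 1) * exp (- c * x)) * indicator {0<..} x)"
    proof (cases "x > 0")
      case True
      have "x ^ n = x ^ (n - j - 1) * x ^ (j + 1)"
        using jn by (subst power_add[symmetric]) simp
      then have "ennreal (fact j / x ^ (j + 1)) * ennreal (x ^ n * exp (- c * x)) = ennreal (fact j * (x ^ (n - j - 1) * exp (- c * x)))"
        using True by (simp add: ennreal_mult'[symmetric])
      then show ?thesis using True nn_integral_power_exp[OF True, of j]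
        by (subst nn_integral_multc) (auto simp: ennreal_mult'[symmetric])
    qed auto
  qed
  also have "\<dots> = ennreal (fact j) * ennreal (fact (n - j - 1) / c ^ (n - j))"
  proof -
    have "n - j - 1 + 1 = n - j" using jn by simp
    then show ?thesis using nz[OF c, of "n - j - 1"] by (subst nn_integral_cmult) auto
  qed
  finally have "ennreal (fact n) * (\<integral>\<^sup>+s. (ennreal (s ^ j / (c + s) ^ (n + 1)) * indicator {0..} s) \<partial>lborel)
      = ennreal (fact j * fact (n - j - 1) / c ^ (n - j))"
    unfolding 1[symmetric] using c by (simp add: ennreal_mult[symmetric])
  then have "ennreal (1 / fact n) * (ennreal (fact n) * (\<integral>\<^sup>+s. (ennreal (s ^ j / (c + s) ^ (n + 1)) * indicator {0..} s) \<partial>lborel))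
      = ennreal (1 / fact n) * ennreal (fact j * fact (n - j - 1) / c ^ (n - j))" by simp
  then show ?thesis using c
    by (simp add: mult.assoc[symmetric] ennreal_mult'[symmetric] ennreal_mult[symmetric] del: fact_Suc)
qed

text \<open>The disc \<open>cmod z^2 \<le> x\<close> has area \<open>pi * x\<close>. This replaces polar coordinates for radial integrands.\<close>

lemma distr_cmod_sq:
  "distr lborel borel (\<lambda>z::complex. (cmod z)\<^sup>2) = density lborel (\<lambda>s. ennreal pi * indicator {0..} s)"
proof -
  have 1: "emeasure (distr lborel borel (\<lambda>z::complex. (cmod z)\<^sup>2)) {..x} = ennreal (pi * max 0 x)" for x :: real
  proof -
    have "emeasure (distr lborel borel (\<lambda>z::complex. (cmod z)\<^sup>2)) {..x} = emeasure lborel {z::complex. (cmod z)\<^sup>2 \<le> x}"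
      by (subst emeasure_distr) (auto intro!: arg_cong[where f="emeasure lborel"])
    also have "\<dots> = ennreal (pi * max 0 x)"
    proof (cases "x \<ge> 0")
      case True
      have "{z::complex. (cmod z)\<^sup>2 \<le> x} = cball 0 (sqrt x)"
        using True by (auto simp: real_le_rsqrt) (metis norm_ge_zero real_sqrt_le_mono real_sqrt_pow2_iff real_sqrt_unique sqrt_ge_absD abs_of_nonneg)
      then show ?thesis using True by (simp add: emeasure_cball unit_ball_vol_2 max_def)
    next
      case False
      then have "\<not> (cmod z)\<^sup>2 \<le> x" for z
        using zero_le_power2[of "cmod z"] by linarith
      then show ?thesis using False by (simp add: max_def)
    qed
    finally show ?thesis .
  qed
  have 2: "emeasure (density lborel (\<lambda>s. ennreal pi * indicator {0..} s)) {..x} = ennreal (pi * max 0 x)" for x :: real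
  proof -
    have "emeasure (density lborel (\<lambda>s. ennreal pi * indicator {0..} s)) {..x} = (\<integral>\<^sup>+s. ennreal pi * indicator {0..x} s \<partial>lborel)"
      by (subst emeasure_density) (auto intro!: nn_integral_cong simp: indicator_def)
    also have "\<dots> = ennreal (pi * max 0 x)"
      by (subst nn_integral_cmult_indicator) (auto simp: max_def ennreal_mult)
    finally show ?thesis .
  qed
  show ?thesis
  proof (rule measure_eqI_generator_eq[where E="range (\<lambda>a::real. {..a})" and \<Omega>=UNIV and A="\<lambda>n. {..real n}"])
    show "Int_stable (range (\<lambda>a::real. {..a}))"
      by (auto simp: Int_stable_def min_def)
    show "sets (distr lborel borel (\<lambda>z::complex. (cmod z)\<^sup>2)) = sigma_sets UNIV (range (\<lambda>a::real. {..a}))"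
      by (simp, subst borel_eq_atMost) (simp add: sets_measure_of)
    show "sets (density lborel (\<lambda>s::real. ennreal pi * indicator {0..} s)) = sigma_sets UNIV (range (\<lambda>a::real. {..a}))"
      by (simp, subst borel_eq_atMost) (simp add: sets_measure_of)
    show "(\<Union>n. {..real n}) = UNIV"
      by (auto intro: real_arch_simple)
  qed (auto simp: 1 2)
qed

lemma nn_integral_cmod_sq:
  assumes [measurable]: "f \<in> borel_measurable borel"
  shows "(\<integral>\<^sup>+z. f ((cmod z)\<^sup>2) \<partial>lborel) = ennreal pi * (\<integral>\<^sup>+s. f s * indicator {0..} s \<partial>lborel)"
proof -
  have "(\<integral>\<^sup>+z. f ((cmod z)\<^sup>2) \<partial>lborel) = (\<integral>\<^sup>+s. f s \<partial>distr lborel borel (\<lambda>z::complex. (cmod z)\<^sup>2))"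
    by (subst nn_integral_distr) auto
  also have "\<dots> = (\<integral>\<^sup>+s. ennreal pi * (f s * indicator {0..} s) \<partial>lborel)"
    unfolding distr_cmod_sq by (subst nn_integral_density) (auto intro!: nn_integral_cong simp: mult_ac)
  also have "\<dots> = ennreal pi * (\<integral>\<^sup>+s. f s * indicator {0..} s \<partial>lborel)"
    by (subst nn_integral_cmult) auto
  finally show ?thesis .
qed

lemma nn_integral_complex_beta:
  fixes c :: real assumes c: "c > 0" and jn: "j < n"
  shows "(\<integral>\<^sup>+z. ennreal (((cmod z)\<^sup>2) ^ j / (c + (cmod z)\<^sup>2) ^ (n + 1)) \<partial>lborel)
    = ennreal (pi * (fact j * fact (n - j - 1) / (fact n * c ^ (n - j))))"
  using nn_integral_cmod_sq[of "\<lambda>s. ennreal (s ^ j / (c + s) ^ (n + 1))"] nn_integral_beta_prime[OF assms]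
  by (simp add: ennreal_mult'[symmetric])

text \<open>Integrating out \<open>fst z\<close> with \<open>c = 1 + cmod (snd z)^2\<close> leaves an integral of the same shape in \<open>snd z\<close>
with \<open>c = 1\<close>; the factor \<open>fact (d + 1 - j)\<close> cancels between the two.\<close>

lemma nn_integral_monomial:
  "(\<integral>\<^sup>+z. ennreal (((cmod (fst z))\<^sup>2) ^ j * ((cmod (snd z))\<^sup>2) ^ k / (1 + (norm z)\<^sup>2) ^ (i + j + k + 3)) \<partial>(lborel :: (complex \<times> complex) measure))
    = ennreal (pi\<^sup>2 * (fact i * fact j * fact k / fact (i + j + k + 2)))"
proof -
  define d where "d = i + j + k"
  have "(\<integral>\<^sup>+z. ennreal (((cmod (fst z))\<^sup>2) ^ j * ((cmod (snd z))\<^sup>2) ^ k / (1 + (norm z)\<^sup>2) ^ (d + 3)) \<partial>(lborel :: (complex \<times> complex) measure))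
    = (\<integral>\<^sup>+y. \<integral>\<^sup>+x. ennreal (((cmod x)\<^sup>2) ^ j * ((cmod y)\<^sup>2) ^ k / (1 + (cmod x)\<^sup>2 + (cmod y)\<^sup>2) ^ (d + 3)) \<partial>lborel \<partial>lborel)"
    unfolding lborel_prod[symmetric]
    by (subst lborel_pair.nn_integral_snd[symmetric]) (auto simp: norm_prod_def add_ac)
  also have "\<dots> = (\<integral>\<^sup>+y. ennreal (pi * (fact j * fact (d + 1 - j) / fact (d + 2))) * ennreal (((cmod y)\<^sup>2) ^ k / (1 + (cmod y)\<^sup>2) ^ (d + 1 - j + 1)) \<partial>lborel)"
  proof (intro nn_integral_cong)
    fix y :: complex
    have "(\<integral>\<^sup>+x. ennreal (((cmod x)\<^sup>2) ^ j * ((cmod y)\<^sup>2) ^ k / (1 + (cmod x)\<^sup>2 + (cmod y)\<^sup>2) ^ (d + 3)) \<partial>lborel)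
      = (\<integral>\<^sup>+x. ennreal (((cmod y)\<^sup>2) ^ k) * ennreal (((cmod x)\<^sup>2) ^ j / (1 + (cmod y)\<^sup>2 + (cmod x)\<^sup>2) ^ (d + 2 + 1)) \<partial>lborel)"
      by (intro nn_integral_cong) (auto simp: ennreal_mult'[symmetric] add_ac numeral_3_eq_3)
    also have "\<dots> = ennreal (((cmod y)\<^sup>2) ^ k) * ennreal (pi * (fact j * fact (d + 2 - j - 1) / (fact (d + 2) * (1 + (cmod y)\<^sup>2) ^ (d + 2 - j))))"
      by (subst nn_integral_cmult, measurable, subst nn_integral_complex_beta) (auto simp: d_def add_pos_nonneg)
    also have "\<dots> = ennreal (pi * (fact j * fact (d + 1 - j) / fact (d + 2))) * ennreal (((cmod y)\<^sup>2) ^ k / (1 + (cmod y)\<^sup>2) ^ (d + 1 - j + 1))"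
    proof -
      have "d + 2 - j - 1 = d + 1 - j" "d + 2 - j = d + 1 - j + 1" by (auto simp: d_def)
      then show ?thesis
        by (simp add: ennreal_mult'[symmetric] ennreal_mult[symmetric] mult_ac del: fact_Suc)
    qed
    finally show "(\<integral>\<^sup>+x. ennreal (((cmod x)\<^sup>2) ^ j * ((cmod y)\<^sup>2) ^ k / (1 + (cmod x)\<^sup>2 + (cmod y)\<^sup>2) ^ (d + 3)) \<partial>lborel) = \<dots>" .
  qed
  also have "\<dots> = ennreal (pi * (fact j * fact (d + 1 - j) / fact (d + 2))) * ennreal (pi * (fact k * fact (d + 1 - j - k - 1) / (fact (d + 1 - j) * 1 ^ (d + 1 - j - k))))"
    by (subst nn_integral_cmult, measurable, subst nn_integral_complex_beta) (auto simp: d_def)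
  also have "\<dots> = ennreal (pi\<^sup>2 * (fact i * fact j * fact k / fact (d + 2)))"
  proof -
    have "d + 1 - j - k - 1 = i" by (auto simp: d_def)
    then show ?thesis
      by (simp add: ennreal_mult'[symmetric] ennreal_mult[symmetric] power2_eq_square field_simps del: fact_Suc)
  qed
  finally show ?thesis unfolding d_def .
qed

section \<open>Rotation invariance and angular integrals\<close>

lemma lborel_complex:
  "(lborel :: complex measure) = distr (lborel \<Otimes>\<^sub>M lborel) borel (\<lambda>(x, y). Complex x y)"
proof (rule lborel_eqI)
  fix l u :: complex assume lu: "\<And>b. b \<in> Basis \<Longrightarrow> l \<bullet> b \<le> u \<bullet> b"
  have [measurable]: "(\<lambda>(x, y). Complex x y) \<in> lborel \<Otimes>\<^sub>M lborel \<rightarrow>\<^sub>M borel"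
    unfolding Complex_eq by measurable
  have "(\<lambda>(x, y). Complex x y) -` box l u = {Re l<..<Re u} \<times> {Im l<..<Im u}"
    by (auto simp: box_def Basis_complex_def inner_complex_def)
  then show "emeasure (distr (lborel \<Otimes>\<^sub>M lborel) borel (\<lambda>(x, y). Complex x y)) (box l u) = ennreal (prod ((\<bullet>) (u - l)) Basis)"
    using lu[of 1] lu[of \<i>]
    by (subst emeasure_distr)
      (auto simp: space_pair_measure lborel.emeasure_pair_measure_Times Basis_complex_def inner_complex_def ennreal_mult)
qed simp

lemma nn_integral_complex:
  assumes [measurable]: "f \<in> borel_measurable borel"
  shows "(\<integral>\<^sup>+z. f z \<partial>lborel) = (\<integral>\<^sup>+y. \<integral>\<^sup>+x. f (Complex x y) \<partial>lborel \<partial>lborel)"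
    and "(\<integral>\<^sup>+z. f z \<partial>lborel) = (\<integral>\<^sup>+x. \<integral>\<^sup>+y. f (Complex x y) \<partial>lborel \<partial>lborel)"
proof -
  have [measurable]: "(\<lambda>(x, y). Complex x y) \<in> lborel \<Otimes>\<^sub>M lborel \<rightarrow>\<^sub>M borel"
    unfolding Complex_eq by measurable
  have "(\<integral>\<^sup>+z. f z \<partial>lborel) = (\<integral>\<^sup>+p. f (case p of (x, y) \<Rightarrow> Complex x y) \<partial>(lborel \<Otimes>\<^sub>M lborel))"
    by (subst lborel_complex, subst nn_integral_distr) auto
  then show "(\<integral>\<^sup>+z. f z \<partial>lborel) = (\<integral>\<^sup>+y. \<integral>\<^sup>+x. f (Complex x y) \<partial>lborel \<partial>lborel)"
    and "(\<integral>\<^sup>+z. f z \<partial>lborel) = (\<integral>\<^sup>+x. \<integral>\<^sup>+y. f (Complex x y) \<partial>lborel \<partial>lborel)"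
    using lborel_pair.nn_integral_snd[of "\<lambda>p. f (case p of (x, y) \<Rightarrow> Complex x y)"]
      lborel.nn_integral_fst[of "\<lambda>p. f (case p of (x, y) \<Rightarrow> Complex x y)" lborel] by simp_all
qed

text \<open>By Fubini a shear acts on each slice as a translation.\<close>

lemma nn_integral_shear:
  fixes t :: real
  assumes [measurable]: "f \<in> borel_measurable borel"
  shows "(\<integral>\<^sup>+z. f (Complex (Re z + t * Im z) (Im z)) \<partial>lborel) = (\<integral>\<^sup>+z. f z \<partial>lborel)"
    and "(\<integral>\<^sup>+z. f (Complex (Re z) (Im z + t * Re z)) \<partial>lborel) = (\<integral>\<^sup>+z. f z \<partial>lborel)"
proof -
  have [measurable]: "(\<lambda>z. Complex (Re z + t * Im z) (Im z)) \<in> borel_measurable borel"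
     "(\<lambda>z. Complex (Re z) (Im z + t * Re z)) \<in> borel_measurable borel"
     "(\<lambda>x. Complex x y) \<in> borel_measurable borel" "(\<lambda>x. Complex y x) \<in> borel_measurable borel" for y
    unfolding Complex_eq by measurable
  show "(\<integral>\<^sup>+z. f (Complex (Re z + t * Im z) (Im z)) \<partial>lborel) = (\<integral>\<^sup>+z. f z \<partial>lborel)"
    unfolding nn_integral_complex(1)[OF assms]
  proof (subst nn_integral_complex(1), measurable, rule nn_integral_cong)
    fix y :: real
    show "(\<integral>\<^sup>+x. f (Complex (Re (Complex x y) + t * Im (Complex x y)) (Im (Complex x y))) \<partial>lborel) = (\<integral>\<^sup>+x. f (Complex x y) \<partial>lborel)"
      using nn_integral_real_affine[of "\<lambda>x. f (Complex x y)" 1 "t * y"] by (simp add: add_ac)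
  qed
  show "(\<integral>\<^sup>+z. f (Complex (Re z) (Im z + t * Re z)) \<partial>lborel) = (\<integral>\<^sup>+z. f z \<partial>lborel)"
    unfolding nn_integral_complex(2)[OF assms]
  proof (subst nn_integral_complex(2), measurable, rule nn_integral_cong)
    fix x :: real
    show "(\<integral>\<^sup>+y. f (Complex (Re (Complex x y)) (Im (Complex x y) + t * Re (Complex x y))) \<partial>lborel) = (\<integral>\<^sup>+y. f (Complex x y) \<partial>lborel)"
      using nn_integral_real_affine[of "\<lambda>y. f (Complex x y)" 1 "t * x"] by (simp add: add_ac)
  qed
qed

text \<open>A rotation is the product of three shears, with parameters \<open>t\<close>, \<open>sin \<theta>\<close> and \<open>t\<close>, where
\<open>t = (cos \<theta> - 1) / sin \<theta> = - tan (\<theta> / 2)\<close>.\<close>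

lemma lborel_rotate:
  assumes "sin \<theta> \<noteq> 0"
  shows "distr lborel borel ((*) (cis \<theta>)) = (lborel :: complex measure)"
proof -
  define t where "t = (cos \<theta> - 1) / sin \<theta>"
  define A where "A = (\<lambda>z. Complex (Re z + t * Im z) (Im z))"
  define B where "B = (\<lambda>z. Complex (Re z) (Im z + sin \<theta> * Re z))"
  have t: "t * sin \<theta> = cos \<theta> - 1" using assms by (simp add: t_def)
  have t2: "t * (1 + cos \<theta>) = - sin \<theta>"
  proof -
    have "sin \<theta> * (t * (1 + cos \<theta>)) = (t * sin \<theta>) * (1 + cos \<theta>)" by (simp add: algebra_simps)
    also have "\<dots> = (cos \<theta> - 1) * (1 + cos \<theta>)" unfolding t ..
    also have "\<dots> = sin \<theta> * (- sin \<theta>)" using sin_cos_squared_add[of \<theta>] by (simp add: power2_eq_square algebra_simps)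
    finally show ?thesis using assms by (metis mult_cancel_left)
  qed
  have rot: "cis \<theta> * z = A (B (A z))" for z
  proof -
    have "Re z + t * Im z + t * (Im z + sin \<theta> * (Re z + t * Im z)) = Re z * (1 + t * sin \<theta>) + t * (1 + (1 + t * sin \<theta>)) * Im z"
      by (simp add: algebra_simps)
    also have "\<dots> = cos \<theta> * Re z - sin \<theta> * Im z" unfolding t using t2 by (simp add: algebra_simps)
    finally have 1: "Re z + t * Im z + t * (Im z + sin \<theta> * (Re z + t * Im z)) = cos \<theta> * Re z - sin \<theta> * Im z" .
    have "Im z + sin \<theta> * (Re z + t * Im z) = (1 + t * sin \<theta>) * Im z + sin \<theta> * Re z"
      by (simp add: algebra_simps)
    then have 2: "Im z + sin \<theta> * (Re z + t * Im z) = cos \<theta> * Im z + sin \<theta> * Re z" unfolding t by simp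
    have "A (B (A z)) = Complex (Re z + t * Im z + t * (Im z + sin \<theta> * (Re z + t * Im z))) (Im z + sin \<theta> * (Re z + t * Im z))"
      by (simp only: A_def B_def complex.sel)
    also have "\<dots> = Complex (cos \<theta> * Re z - sin \<theta> * Im z) (cos \<theta> * Im z + sin \<theta> * Re z)"
      by (rule arg_cong2[OF 1 2])
    also have "\<dots> = cis \<theta> * z" by (rule complex_eqI) simp_all
    finally show ?thesis ..
  qed
  have [measurable]: "A \<in> borel_measurable borel" "B \<in> borel_measurable borel"
    unfolding A_def B_def Complex_eq by measurable
  show ?thesis
  proof (rule measure_eqI)
    fix X assume "X \<in> sets (distr lborel borel ((*) (cis \<theta>)))"
    then have [measurable]: "X \<in> sets borel" by simp
    have "emeasure (distr lborel borel ((*) (cis \<theta>))) X = (\<integral>\<^sup>+z. indicator X z \<partial>distr lborel borel ((*) (cis \<theta>)))"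
      by simp
    also have "\<dots> = (\<integral>\<^sup>+z. indicator X (A (B (A z))) \<partial>lborel)"
      by (subst nn_integral_distr) (auto simp: rot)
    also have "\<dots> = (\<integral>\<^sup>+z. indicator X (A (B z)) \<partial>lborel)"
      by (subst (2) A_def, rule nn_integral_shear(1)) measurable
    also have "\<dots> = (\<integral>\<^sup>+z. indicator X (A z) \<partial>lborel)"
      unfolding B_def by (rule nn_integral_shear(2)) measurable
    also have "\<dots> = (\<integral>\<^sup>+z. indicator X z \<partial>lborel)"
      unfolding A_def by (rule nn_integral_shear(1)) measurable
    finally show "emeasure (distr lborel borel ((*) (cis \<theta>))) X = emeasure lborel X" by simp
  qed simp
qed

text \<open>Rotating by \<open>\<theta>\<close> multiplies the integrand by \<open>cis ((j - k) * \<theta>)\<close>. For \<open>\<theta> = 1 / (j - k)\<close> this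
factor is \<open>cis 1 \<noteq> 1\<close>, and the rotation itself has \<open>sin \<theta> \<noteq> 0\<close>.\<close>

lemma integral_complex_angular:
  fixes g :: "real \<Rightarrow> complex"
  assumes "j \<noteq> k" and [measurable]: "g \<in> borel_measurable borel"
  shows "(LINT z|lborel. z ^ j * cnj z ^ k * g (cmod z)) = 0"
proof -
  define I where "I = (LINT z|lborel. z ^ j * cnj z ^ k * g (cmod z))"
  define \<theta> where "\<theta> = 1 / (real j - real k)"
  have jk: "\<bar>real j - real k\<bar> \<ge> 1" using assms by linarith
  have "\<bar>\<theta>\<bar> \<le> 1" "\<theta> \<noteq> 0" using jk by (auto simp: \<theta>_def divide_simps)
  have s: "sin \<theta> \<noteq> 0"
  proof
    assume "sin \<theta> = 0"
    then have "sin \<bar>\<theta>\<bar> = 0" by (cases "\<theta> \<ge> 0") auto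
    moreover have "sin \<bar>\<theta>\<bar> > 0" using \<open>\<theta> \<noteq> 0\<close> \<open>\<bar>\<theta>\<bar> \<le> 1\<close> pi_gt3 by (intro sin_gt_zero) auto
    ultimately show False by simp
  qed
  have "cis \<theta> ^ j * cnj (cis \<theta>) ^ k = cis (real j * \<theta> + real k * (- \<theta>))"
    unfolding cis_cnj Complex.DeMoivre cis_mult ..
  also have "real j * \<theta> + real k * (- \<theta>) = 1"
  proof -
    have "real j * \<theta> + real k * (- \<theta>) = (real j - real k) * \<theta>" by (simp add: algebra_simps)
    then show ?thesis using jk by (simp add: \<theta>_def)
  qed
  finally have c: "cis \<theta> ^ j * cnj (cis \<theta>) ^ k = cis 1" .
  have [measurable]: "cnj \<in> borel_measurable borel"
    by (intro borel_measurable_continuous_onI continuous_intros)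
  have "I = (LINT z|distr lborel borel ((*) (cis \<theta>)). z ^ j * cnj z ^ k * g (cmod z))"
    unfolding lborel_rotate[OF s] I_def ..
  also have "\<dots> = (LINT z|lborel. cis 1 * (z ^ j * cnj z ^ k * g (cmod z)))"
    by (subst integral_distr) (auto simp: power_mult_distrib norm_mult c[symmetric] mult_ac)
  also have "\<dots> = cis 1 * I" unfolding I_def by (subst integral_mult_right_zero) auto
  finally have "I * (1 - cis 1) = 0" by (simp add: algebra_simps)
  moreover have "cis 1 \<noteq> 1"
  proof
    assume "cis 1 = 1"
    then have "sin (1::real) = 0" by (simp add: complex_eq_iff)
    moreover have "sin (1::real) > 0" using pi_gt3 by (intro sin_gt_zero) auto
    ultimately show False by simp
  qed
  ultimately show ?thesis unfolding I_def by simp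
qed

section \<open>The Fubini-Study norm in coordinates\<close>

lemma finite_monoms [simp, intro]: "finite (monoms d)"
proof (rule finite_subset)
  show "monoms d \<subseteq> {..d} \<times> {..d} \<times> {..d}" by (auto simp: monoms_def)
qed auto

text \<open>The squared \<open>L\<^sup>2\<close> norm of the monomial with exponents \<open>(i, j, k)\<close>.\<close>

definition l2_weight :: "nat \<times> nat \<times> nat \<Rightarrow> real" where
  "l2_weight = (\<lambda>(i, j, k). 2 * fact i * fact j * fact k / fact (i + j + k + 2))"

lemma l2_weight_pos: "l2_weight a > 0"
  by (cases a) (auto simp: l2_weight_def)

definition chart_monomial :: "nat \<times> nat \<times> nat \<Rightarrow> complex \<times> complex \<Rightarrow> complex" where
  "chart_monomial = (\<lambda>(i, j, k) z. fst z ^ j * snd z ^ k)"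

lemma chart_monomial_measurable [measurable]: "chart_monomial a \<in> borel_measurable borel"
proof (cases a)
  case (fields i j k)
  show ?thesis unfolding chart_monomial_def fields prod.case
    by (intro borel_measurable_continuous_onI continuous_intros)
qed

text \<open>Two different monomials of the same degree differ in the exponent of one of the two affine
coordinates; the angular integral in that coordinate vanishes. Integrability of the mixed terms
follows from the diagonal ones by \<open>xy \<le> x^2 + y^2\<close>.\<close>

lemma chart_monomials_orthogonal:
  assumes "a \<in> monoms d" "b \<in> monoms d"
  shows "integrable lborel (\<lambda>z. chart_monomial a z * cnj (chart_monomial b z) * of_real (1 / (1 + (norm z)\<^sup>2) ^ (d + 3)))" (is "integrable _ ?f")
    and "(LINT z|lborel. chart_monomial a z * cnj (chart_monomial b z) * of_real (1 / (1 + (norm z)\<^sup>2) ^ (d + 3)))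
      = (if a = b then of_real (pi\<^sup>2 / 2 * l2_weight a) else 0)"
proof -
  have [measurable]: "cnj \<in> borel_measurable borel"
    by (intro borel_measurable_continuous_onI continuous_intros)
  define g where "g = (\<lambda>c (z :: complex \<times> complex). (cmod (chart_monomial c z))\<^sup>2 / (1 + (norm z)\<^sup>2) ^ (d + 3))"
  have g0: "g c z \<ge> 0" for c z by (simp add: g_def)
  have [measurable]: "g c \<in> borel_measurable borel" for c unfolding g_def by measurable
  have gi: "(\<integral>\<^sup>+z. ennreal (g c z) \<partial>lborel) = ennreal (pi\<^sup>2 / 2 * l2_weight c)" if "c \<in> monoms d" for c
  proof (cases c)
    case (fields i j k)
    have d: "d = i + j + k" using that fields by (auto simp: monoms_def)
    have "(cmod (chart_monomial c z))\<^sup>2 = ((cmod (fst z))\<^sup>2) ^ j * ((cmod (snd z))\<^sup>2) ^ k" for z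
      by (simp add: chart_monomial_def fields norm_mult norm_power power_mult_distrib power_mult[symmetric] mult.commute)
    then show ?thesis
      using nn_integral_monomial[of j k i] unfolding g_def d by (simp add: fields l2_weight_def del: fact_Suc)
  qed
  have gI: "integrable lborel (g c)" if "c \<in> monoms d" for c
    by (intro integrableI_bounded) (auto simp: g0 gi[OF that])
  show int: "integrable lborel ?f"
  proof (rule Bochner_Integration.integrable_bound[OF Bochner_Integration.integrable_add[OF gI[OF assms(1)] gI[OF assms(2)]]])
    show "AE z in lborel. norm (?f z) \<le> norm (g a z + g b z)"
    proof (intro AE_I2)
      fix z :: "complex \<times> complex"
      have "cmod (chart_monomial a z) * cmod (chart_monomial b z) \<le> (cmod (chart_monomial a z))\<^sup>2 + (cmod (chart_monomial b z))\<^sup>2"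
        using sum_squares_bound[of "cmod (chart_monomial a z)" "cmod (chart_monomial b z)"]
          mult_nonneg_nonneg[OF norm_ge_zero[of "chart_monomial a z"] norm_ge_zero[of "chart_monomial b z"]] by linarith
      then have "cmod (chart_monomial a z) * cmod (chart_monomial b z) * (1 / (1 + (norm z)\<^sup>2) ^ (d + 3)) \<le> g a z + g b z"
        unfolding g_def add_divide_distrib[symmetric] by (simp add: divide_right_mono)
      moreover have "norm (?f z) = cmod (chart_monomial a z) * cmod (chart_monomial b z) * (1 / (1 + (norm z)\<^sup>2) ^ (d + 3))"
        unfolding norm_mult complex_mod_cnj norm_of_real by simp
      ultimately have "norm (?f z) \<le> g a z + g b z" by simp
      then show "norm (?f z) \<le> norm (g a z + g b z)" by simp
    qed
  qed measurable
  obtain i j k where a: "a = (i, j, k)" by (cases a)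
  obtain i' j' k' where b: "b = (i', j', k')" by (cases b)
  show "(LINT z|lborel. ?f z) = (if a = b then of_real (pi\<^sup>2 / 2 * l2_weight a) else 0)"
  proof (cases "a = b")
    case True
    have f: "?f = (\<lambda>z. of_real (g a z))"
      unfolding True[symmetric] complex_norm_square[symmetric] g_def by simp
    have gint: "integral\<^sup>L lborel (g a) = pi\<^sup>2 / 2 * l2_weight a"
      using gi[OF assms(1)] l2_weight_pos[of a] by (subst integral_eq_nn_integral) (auto simp: g0 less_imp_le)
    show ?thesis unfolding f integral_complex_of_real gint using True by (simp only: simp_thms if_True)
  next
    case False
    have h: "norm z ^ 2 = (cmod (fst z))\<^sup>2 + (cmod (snd z))\<^sup>2" for z :: "complex \<times> complex"
      by (simp add: norm_prod_def)
    have "j \<noteq> j' \<or> k \<noteq> k'" using False assms by (auto simp: a b monoms_def)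
    moreover have ?thesis if "j \<noteq> j'"
    proof -
      have "(LINT z|lborel. ?f z) = (LINT y|lborel. LINT x|lborel. ?f (x, y))"
        using int lborel_pair.integral_snd[of "\<lambda>x y. ?f (x, y)"] unfolding lborel_prod split_def prod.collapse by simp
      also have "\<dots> = 0"
      proof (rule integral_eq_zero_AE, rule AE_I2)
        fix y :: complex
        have "(LINT x|lborel. ?f (x, y)) = (LINT x|lborel. x ^ j * cnj x ^ j' * 
          (\<lambda>r. y ^ k * cnj y ^ k' * of_real (1 / (1 + (r\<^sup>2 + (cmod y)\<^sup>2)) ^ (d + 3))) (cmod x))"
          by (intro Bochner_Integration.integral_cong) (auto simp: h a b chart_monomial_def mult_ac)
        also have "\<dots> = 0" by (rule integral_complex_angular[OF that]) measurable
        finally show "(LINT x|lborel. ?f (x, y)) = 0" .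
      qed
      finally show ?thesis using False by simp
    qed
    moreover have ?thesis if "k \<noteq> k'"
    proof -
      have "(LINT z|lborel. ?f z) = (LINT x|lborel. LINT y|lborel. ?f (x, y))"
        using int lborel_pair.integral_fst[of "\<lambda>x y. ?f (x, y)"] unfolding lborel_prod split_def prod.collapse by simp
      also have "\<dots> = 0"
      proof (rule integral_eq_zero_AE, rule AE_I2)
        fix x :: complex
        have "(LINT y|lborel. ?f (x, y)) = (LINT y|lborel. y ^ k * cnj y ^ k' * 
          (\<lambda>r. x ^ j * cnj x ^ j' * of_real (1 / (1 + ((cmod x)\<^sup>2 + r\<^sup>2)) ^ (d + 3))) (cmod y))"
          by (intro Bochner_Integration.integral_cong) (auto simp: h a b chart_monomial_def mult_ac)
        also have "\<dots> = 0" by (rule integral_complex_angular[OF that]) measurable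
        finally show "(LINT y|lborel. ?f (x, y)) = 0" .
      qed
      finally show ?thesis using False by simp
    qed
    ultimately show ?thesis by blast
  qed
qed

lemma measure_fs_volume: "measure fs_volume UNIV = pi\<^sup>2 / 2"
proof -
  have "emeasure fs_volume UNIV = ennreal (pi\<^sup>2 / 2)"
    using nn_integral_monomial[of 0 0 0] unfolding fs_volume_def
    by (subst emeasure_density) (auto simp: fact_numeral)
  then show ?thesis by (simp add: measure_def)
qed

lemma hpoly_eval_chart:
  "hpoly_eval d P (vector [1, fst z, snd z]) = (\<Sum>a\<in>monoms d. of_real (P a) * chart_monomial a z)"
  unfolding hpoly_eval_def chart_monomial_def
  by (intro sum.cong) (auto simp: split_beta)

lemma l2_norm_sq_eq: "l2_norm_sq d P = (\<Sum>a\<in>monoms d. l2_weight a * (P a)\<^sup>2)"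
proof -
  let ?h = "\<lambda>a b (z :: complex \<times> complex). chart_monomial a z * cnj (chart_monomial b z) * of_real (1 / (1 + (norm z)\<^sup>2) ^ (d + 3))"
  have norm_vec: "norm (vector [1, fst z, snd z] :: complex ^ 3) ^ (2 * d) = (1 + (norm z)\<^sup>2) ^ d" for z :: "complex \<times> complex"
  proof -
    have "(norm (vector [1, fst z, snd z] :: complex ^ 3))\<^sup>2 = 1 + (norm z)\<^sup>2"
      by (simp add: norm_vec_def L2_set_def sum_3 norm_prod_def)
    then show ?thesis by (simp add: power_mult)
  qed
  have pt: "complex_of_real ((1 / (1 + (norm z)\<^sup>2) ^ 3) * fs_norm_sq d P (vector [1, fst z, snd z]))
     = (\<Sum>a\<in>monoms d. \<Sum>b\<in>monoms d. of_real (P a * P b) * ?h a b z)" (is "?l = ?r") for z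
  proof -
    have "?l = of_real ((cmod (\<Sum>a\<in>monoms d. of_real (P a) * chart_monomial a z))\<^sup>2) * of_real (1 / (1 + (norm z)\<^sup>2) ^ (d + 3))"
      unfolding fs_norm_sq_def norm_vec hpoly_eval_chart
      by (simp add: power_add mult.commute)
    also have "of_real ((cmod (\<Sum>a\<in>monoms d. of_real (P a) * chart_monomial a z))\<^sup>2) = 
       (\<Sum>a\<in>monoms d. of_real (P a) * chart_monomial a z) * (\<Sum>b\<in>monoms d. of_real (P b) * cnj (chart_monomial b z))"
      unfolding complex_norm_square by simp
    also have "\<dots> * of_real (1 / (1 + (norm z)\<^sup>2) ^ (d + 3)) = ?r"
      unfolding sum_product by (simp only: sum_distrib_right) (intro sum.cong refl, simp only: of_real_mult mult_ac)
    finally show ?thesis .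
  qed
  have meas: "(\<lambda>z::complex \<times> complex. fs_norm_sq d P (vector [1, fst z, snd z])) \<in> borel_measurable borel"
    unfolding fs_norm_sq_def norm_vec hpoly_eval_chart by measurable
  have "complex_of_real (LINT z|fs_volume. fs_norm_sq d P (vector [1, fst z, snd z]))
    = complex_of_real (LINT z|lborel. (1 / (1 + (norm z)\<^sup>2) ^ 3) * fs_norm_sq d P (vector [1, fst z, snd z]))"
    unfolding fs_volume_def using meas by (subst integral_density) auto
  also have "\<dots> = (LINT z|lborel. (\<Sum>a\<in>monoms d. \<Sum>b\<in>monoms d. of_real (P a * P b) * ?h a b z))"
    unfolding pt[symmetric] by (rule integral_complex_of_real[symmetric])
  also have "\<dots> = (\<Sum>a\<in>monoms d. \<Sum>b\<in>monoms d. of_real (P a * P b) * (LINT z|lborel. ?h a b z))"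
    by (subst Bochner_Integration.integral_sum, 
        intro Bochner_Integration.integrable_sum integrable_mult_right chart_monomials_orthogonal, assumption, assumption,
        intro sum.cong refl, subst Bochner_Integration.integral_sum,
        intro integrable_mult_right chart_monomials_orthogonal, assumption, assumption,
        intro sum.cong refl integral_mult_right_zero)
  also have "\<dots> = (\<Sum>a\<in>monoms d. \<Sum>b\<in>monoms d. if a = b then of_real ((P a)\<^sup>2 * (pi\<^sup>2 / 2 * l2_weight a)) else 0)"
    by (intro sum.cong refl) (simp only: chart_monomials_orthogonal(2) if_distrib, auto simp: power2_eq_square)
  also have "\<dots> = of_real (\<Sum>a\<in>monoms d. (P a)\<^sup>2 * (pi\<^sup>2 / 2 * l2_weight a))"
    by (simp add: sum.delta)
  finally have "(LINT z|fs_volume. fs_norm_sq d P (vector [1, fst z, snd z])) = (\<Sum>a\<in>monoms d. (P a)\<^sup>2 * (pi\<^sup>2 / 2 * l2_weight a))"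
    unfolding of_real_eq_iff .
  then show ?thesis
    unfolding l2_norm_sq_def measure_fs_volume sum_distrib_left
    by (simp add: sum_distrib_left mult_ac)
qed

lemma l2_inner_eq: "l2_inner d P Q = (\<Sum>a\<in>monoms d. l2_weight a * (P a * Q a))"
proof -
  have "4 * l2_inner d P Q = (\<Sum>a\<in>monoms d. l2_weight a * (P a + Q a)\<^sup>2) - (\<Sum>a\<in>monoms d. l2_weight a * (P a - Q a)\<^sup>2)"
    unfolding l2_inner_def l2_norm_sq_eq by simp
  also have "\<dots> = (\<Sum>a\<in>monoms d. 4 * (l2_weight a * (P a * Q a)))"
    unfolding sum_subtractf[symmetric] by (intro sum.cong) (auto simp: power2_eq_square algebra_simps)
  also have "\<dots> = 4 * (\<Sum>a\<in>monoms d. l2_weight a * (P a * Q a))" by (simp add: sum_distrib_left)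
  finally show ?thesis by simp
qed

section \<open>The reproducing kernel\<close>

lemma sum_monoms:
  "sum f (monoms d) = (\<Sum>i\<le>d. \<Sum>j\<le>d - i. f (i, j, d - i - j))"
proof -
  let ?g = "\<lambda>(i, j). (i, j, d - i - j)"
  have m: "monoms d = ?g ` (SIGMA i:{..d}. {..d - i})"
    by (auto simp: monoms_def image_iff)
  have "sum f (monoms d) = (\<Sum>p\<in>(SIGMA i:{..d}. {..d - i}). f (?g p))"
    unfolding m by (subst sum.reindex) (auto simp: inj_on_def)
  also have "\<dots> = (\<Sum>i\<le>d. \<Sum>j\<le>d - i. f (i, j, d - i - j))"
    by (subst sum.Sigma) (auto simp: split_beta)
  finally show ?thesis .
qed

lemma card_monoms: "card (monoms d) = dim_hpolys d"
proof -
  have "card (monoms d) = (\<Sum>i\<le>d. Suc (d - i))"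
    unfolding card_eq_sum sum_monoms by simp
  also have "\<dots> = (\<Sum>i\<le>d. Suc i)"
    by (rule sum.nat_diff_reindex[where n="Suc d", simplified lessThan_Suc_atMost, simplified])
  also have "\<dots> = (d + 2) choose 2"
    by (induction d) (auto simp: numeral_2_eq_2)
  finally show ?thesis unfolding dim_hpolys_def .
qed

lemma trinomial:
  fixes x y z :: real
  shows "(\<Sum>(i, j, k)\<in>monoms d. fact d / (fact i * fact j * fact k) * (x ^ i * y ^ j * z ^ k)) = (x + y + z) ^ d"
proof -
  have "(x + y + z) ^ d = (\<Sum>i\<le>d. of_nat (d choose i) * x ^ i * (y + z) ^ (d - i))"
    using binomial_ring[of x "y + z" d] by (simp add: add.assoc)
  also have "\<dots> = (\<Sum>i\<le>d. \<Sum>j\<le>d - i. of_nat (d choose i) * x ^ i * (of_nat ((d - i) choose j) * y ^ j * z ^ (d - i - j)))"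
    unfolding binomial_ring[of y z] sum_distrib_left ..
  also have "\<dots> = (\<Sum>i\<le>d. \<Sum>j\<le>d - i. fact d / (fact i * fact j * fact (d - i - j)) * (x ^ i * y ^ j * z ^ (d - i - j)))"
    by (intro sum.cong refl) (auto simp: binomial_fact)
  finally show ?thesis unfolding sum_monoms by simp
qed

text \<open>Let \<open>G\<close> be the Gram matrix of the columns. Orthonormality of the rows makes \<open>G\<close> a symmetric idempotent, so
\<open>G a a = (\<Sum>c. (G a c)^2) \<ge> (G a a)^2\<close> and hence \<open>G a a \<le> 1\<close>. Its trace equals that of the row
Gram matrix, which is the number of rows, hence of columns; so every diagonal entry is \<open>1\<close> and every other entry \<open>0\<close>.\<close>

lemma orthonormal_rows_imp_columns:
  fixes B :: "'i \<Rightarrow> 'a \<Rightarrow> real"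
  assumes fin: "finite I" "finite A" and card: "card I = card A"
    and rows: "\<And>i j. i \<in> I \<Longrightarrow> j \<in> I \<Longrightarrow> (\<Sum>a\<in>A. B i a * B j a) = (if i = j then 1 else 0)"
    and ac: "a \<in> A" "c \<in> A"
  shows "(\<Sum>i\<in>I. B i a * B i c) = (if a = c then 1 else 0)"
proof -
  define G where "G a c = (\<Sum>i\<in>I. B i a * B i c)" for a c
  have sym: "G a c = G c a" for a c by (simp add: G_def mult.commute)
  \<comment> \<open>Orthonormality of the rows is used here: the inner sum over \<open>c\<close> is the row Gram matrix.\<close>
  have idem: "(\<Sum>c\<in>A. G a c * G c e) = G a e" for a e
  proof -
    have "(\<Sum>c\<in>A. G a c * G c e) = (\<Sum>c\<in>A. \<Sum>i\<in>I. \<Sum>j\<in>I. B i a * B j e * (B i c * B j c))"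
      unfolding G_def sum_product by (simp add: mult_ac)
    also have "\<dots> = (\<Sum>i\<in>I. \<Sum>j\<in>I. \<Sum>c\<in>A. B i a * B j e * (B i c * B j c))"
      by (subst sum.swap, intro sum.cong refl sum.swap)
    also have "\<dots> = (\<Sum>i\<in>I. \<Sum>j\<in>I. B i a * B j e * (if i = j then 1 else 0))"
      unfolding sum_distrib_left[symmetric] using rows by (intro sum.cong refl) auto
    also have "\<dots> = G a e" unfolding G_def using fin by (simp add: if_distrib sum.delta cong: if_cong)
    finally show ?thesis .
  qed
  have sq: "G a a = (\<Sum>c\<in>A. (G a c)\<^sup>2)" for a
  proof -
    have "(G a c)\<^sup>2 = G a c * G c a" for c using sym[of a c] by (metis power2_eq_square)
    then show ?thesis using idem[of a a] by simp
  qed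
  have le1: "G a a \<le> 1" if "a \<in> A" for a
  proof -
    have "(G a a)\<^sup>2 \<le> G a a"
      using member_le_sum[of a A "\<lambda>c. (G a c)\<^sup>2"] that fin by (simp flip: sq)
    moreover have "(G a a)\<^sup>2 > G a a" if "G a a > 1" using that by (simp add: power2_eq_square)
    ultimately show ?thesis by fastforce
  qed
  have "(\<Sum>a\<in>A. G a a) = (\<Sum>i\<in>I. \<Sum>a\<in>A. B i a * B i a)"
    unfolding G_def by (rule sum.swap)
  also have "\<dots> = real (card A)" using rows by (simp add: card)
  finally have "(\<Sum>a\<in>A. 1 - G a a) = 0" by (simp add: sum_subtractf)
  then have diag: "G a a = 1" if "a \<in> A" for a
    using that le1 fin by (subst (asm) sum_nonneg_eq_0_iff) auto
  show ?thesis
  proof (cases "a = c")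
    case True then show ?thesis using diag ac by (simp add: G_def)
  next
    case False
    have "1 = (G a a)\<^sup>2 + (\<Sum>c\<in>A - {a}. (G a c)\<^sup>2)"
      using sq[of a] diag[OF ac(1)] sum.remove[OF fin(2) ac(1), of "\<lambda>c. (G a c)\<^sup>2"] by simp
    then have "(\<Sum>c\<in>A - {a}. (G a c)\<^sup>2) = 0" using diag[OF ac(1)] by simp
    then have "(G a c)\<^sup>2 = 0" using fin ac False by (subst (asm) sum_nonneg_eq_0_iff) auto
    then show ?thesis using False by (simp add: G_def)
  qed
qed

lemma hpoly_eval_real:
  fixes X :: "real ^ 3"
  shows "hpoly_eval d P X = (\<Sum>a\<in>monoms d. P a * (case a of (i, j, k) \<Rightarrow> X $ 1 ^ i * X $ 2 ^ j * X $ 3 ^ k))"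
  unfolding hpoly_eval_def by (intro sum.cong) (auto simp: mult_ac)

lemma inverse_l2_weight:
  assumes "(i, j, k) \<in> monoms d"
  shows "1 / l2_weight (i, j, k) = real (dim_hpolys d) * (fact d / (fact i * fact j * fact k))"
proof -
  have "real (dim_hpolys d) = fact (d + 2) / (2 * fact d)"
    unfolding dim_hpolys_def by (subst binomial_fact) (auto simp: fact_numeral)
  moreover have "d = i + j + k" using assms by (auto simp: monoms_def)
  ultimately show ?thesis by (simp add: l2_weight_def del: fact_Suc)
qed

text \<open>In the rescaled coordinates \<open>sqrt (l2_weight a) * b i a\<close> an orthonormal basis is a square matrix with
orthonormal rows, hence with orthonormal columns. So the kernel does not depend on the basis, and
for monomials it is the trinomial expansion of \<open>(X \<bullet> Y)^d\<close>.\<close>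

lemma reproducing_kernel:
  assumes "orthonormal_basis d b"
  shows "(\<Sum>i<dim_hpolys d. hpoly_eval d (b i) X * hpoly_eval d (b i) Y) = real (dim_hpolys d) * (X \<bullet> Y) ^ d"
proof -
  let ?N = "dim_hpolys d"
  define M where "M X = (\<lambda>(i, j, k). X $ 1 ^ i * X $ 2 ^ j * X $ 3 ^ k)" for X :: "real ^ 3"
  have inner: "(\<Sum>i<?N. b i a * b i c) = (if a = c then 1 / l2_weight a else 0)" if "a \<in> monoms d" "c \<in> monoms d" for a c
  proof -
    have "(\<Sum>i<?N. (sqrt (l2_weight a) * b i a) * (sqrt (l2_weight c) * b i c)) = (if a = c then 1 else 0)"
    proof (rule orthonormal_rows_imp_columns[where A="monoms d"])
      fix i j assume "i \<in> {..<?N}" "j \<in> {..<?N}"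
      then have "l2_inner d (b i) (b j) = (if i = j then 1 else 0)"
        using assms by (auto simp: orthonormal_basis_def)
      moreover have "(\<Sum>a\<in>monoms d. (sqrt (l2_weight a) * b i a) * (sqrt (l2_weight a) * b j a)) = l2_inner d (b i) (b j)"
        unfolding l2_inner_eq
      proof (intro sum.cong refl)
        fix a
        have "sqrt (l2_weight a) * b i a * (sqrt (l2_weight a) * b j a) = (sqrt (l2_weight a))\<^sup>2 * (b i a * b j a)"
          unfolding power2_eq_square by (simp only: mult_ac)
        then show "sqrt (l2_weight a) * b i a * (sqrt (l2_weight a) * b j a) = l2_weight a * (b i a * b j a)"
          using l2_weight_pos[of a] by simp
      qed
      ultimately show "(\<Sum>a\<in>monoms d. (sqrt (l2_weight a) * b i a) * (sqrt (l2_weight a) * b j a)) = (if i = j then 1 else 0)"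
        by simp
    qed (use that in \<open>auto simp: card_monoms\<close>)
    also have "(\<Sum>i<?N. (sqrt (l2_weight a) * b i a) * (sqrt (l2_weight c) * b i c)) = sqrt (l2_weight a) * sqrt (l2_weight c) * (\<Sum>i<?N. b i a * b i c)"
      by (simp add: sum_distrib_left mult_ac)
    finally have "sqrt (l2_weight a) * sqrt (l2_weight c) * (\<Sum>i<?N. b i a * b i c) = (if a = c then 1 else 0)" .
    moreover have "sqrt (l2_weight c) * sqrt (l2_weight c) = l2_weight c" using l2_weight_pos[of c] by simp
    ultimately show ?thesis using l2_weight_pos[of a] l2_weight_pos[of c] by (cases "a = c") (auto simp: eq_divide_eq mult.commute)
  qed
  have "(\<Sum>i<?N. hpoly_eval d (b i) X * hpoly_eval d (b i) Y)
     = (\<Sum>i<?N. \<Sum>a\<in>monoms d. \<Sum>c\<in>monoms d. M X a * M Y c * (b i a * b i c))"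
    unfolding hpoly_eval_real M_def[symmetric] sum_product by (simp add: mult_ac)
  also have "\<dots> = (\<Sum>a\<in>monoms d. \<Sum>c\<in>monoms d. \<Sum>i<?N. M X a * M Y c * (b i a * b i c))"
    by (subst sum.swap, intro sum.cong refl sum.swap)
  also have "\<dots> = (\<Sum>a\<in>monoms d. \<Sum>c\<in>monoms d. if a = c then M X a * M Y a * (1 / l2_weight a) else 0)"
    unfolding sum_distrib_left[symmetric] using inner by (intro sum.cong refl) auto
  also have "\<dots> = (\<Sum>a\<in>monoms d. M X a * M Y a * (1 / l2_weight a))" by (simp add: sum.delta)
  also have "\<dots> = (\<Sum>(i, j, k)\<in>monoms d. real ?N * (fact d / (fact i * fact j * fact k) * ((X $ 1 * Y $ 1) ^ i * (X $ 2 * Y $ 2) ^ j * (X $ 3 * Y $ 3) ^ k)))"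
  proof (intro sum.cong refl)
    fix a assume a: "a \<in> monoms d"
    obtain i j k where ijk: "a = (i, j, k)" by (cases a)
    show "M X a * M Y a * (1 / l2_weight a) = (case a of (i, j, k) \<Rightarrow> real ?N * (fact d / (fact i * fact j * fact k) * ((X $ 1 * Y $ 1) ^ i * (X $ 2 * Y $ 2) ^ j * (X $ 3 * Y $ 3) ^ k)))"
      unfolding ijk inverse_l2_weight[OF a[unfolded ijk]] by (simp add: M_def power_mult_distrib)
  qed
  also have "\<dots> = real ?N * (\<Sum>(i, j, k)\<in>monoms d. fact d / (fact i * fact j * fact k) * ((X $ 1 * Y $ 1) ^ i * (X $ 2 * Y $ 2) ^ j * (X $ 3 * Y $ 3) ^ k))"
    unfolding sum_distrib_left by (simp add: split_beta)
  also have "\<dots> = real ?N * (X \<bullet> Y) ^ d"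
    unfolding trinomial by (simp add: inner_vec_def sum_3)
  finally show ?thesis .
qed

lemma orthonormal_basis_exists: "\<exists>b. orthonormal_basis d b"
proof -
  let ?N = "dim_hpolys d"
  obtain h where h: "bij_betw h {0..<?N} (monoms d)"
    using ex_bij_betw_nat_finite[OF finite_monoms] card_monoms by metis
  define b where "b i = (\<lambda>a\<in>monoms d. if a = h i then 1 / sqrt (l2_weight a) else 0)" for i
  have hm: "h i \<in> monoms d" if "i < ?N" for i using h that by (auto simp: bij_betw_def)
  have "l2_inner d (b i) (b j) = (if i = j then 1 else 0)" if "i < ?N" "j < ?N" for i j
  proof -
    have "h i = h j \<longleftrightarrow> i = j" using h that by (auto simp: bij_betw_def inj_on_def)
    moreover have "l2_inner d (b i) (b j) = (\<Sum>a\<in>monoms d. if a = h i then (if h i = h j then 1 else 0) else 0)"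
      unfolding l2_inner_eq
    proof (intro sum.cong refl)
      fix a assume "a \<in> monoms d"
      then show "l2_weight a * (b i a * b j a) = (if a = h i then (if h i = h j then 1 else 0) else 0)"
        using l2_weight_pos[of a] by (auto simp: b_def)
    qed
    ultimately show ?thesis using hm[OF that(1)] by (simp add: sum.delta)
  qed
  then have "orthonormal_basis d b"
    unfolding orthonormal_basis_def hpolys_def by (auto simp: b_def)
  then show ?thesis by blast
qed

section \<open>The standard Gaussian measure\<close>

text \<open>Each coordinate has variance \<open>1/2\<close>, so that the density is \<open>exp (- |x|^2)\<close> up to normalization.\<close>

definition std_gauss :: "nat \<Rightarrow> (nat \<Rightarrow> real) measure" where
  "std_gauss N = density (\<Pi>\<^sub>M i\<in>{..<N}. lborel)
     (\<lambda>x. ennreal (pi powr (- real N / 2) * exp (- (\<Sum>i<N. (x i)\<^sup>2))))"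

lemma space_std_gauss: "space (std_gauss N) = (\<Pi>\<^sub>E i\<in>{..<N}. UNIV)"
  by (simp add: std_gauss_def space_PiM)

lemma sets_std_gauss [measurable_cong]: "sets (std_gauss N) = sets (\<Pi>\<^sub>M i\<in>{..<N}. borel)"
  unfolding std_gauss_def by (simp cong: sets_PiM_cong)

lemma nn_integral_std_gauss:
  assumes "f \<in> borel_measurable (\<Pi>\<^sub>M i\<in>{..<N}. borel)"
  shows "(\<integral>\<^sup>+x. f x \<partial>std_gauss N)
    = (\<integral>\<^sup>+x. ennreal (pi powr (- real N / 2) * exp (- (\<Sum>i<N. (x i)\<^sup>2))) * f x \<partial>(\<Pi>\<^sub>M i\<in>{..<N}. lborel))"
proof -
  have [measurable]: "f \<in> borel_measurable (\<Pi>\<^sub>M i\<in>{..<N}. lborel)"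
    using assms by (simp cong: measurable_cong_sets sets_PiM_cong)
  show ?thesis unfolding std_gauss_def by (subst nn_integral_density) auto
qed

text \<open>Completing the square in each coordinate turns the integrand into a product of normal densities
with means \<open>y i / 2\<close>.\<close>

lemma std_gauss_mgf:
  "(\<integral>\<^sup>+x. ennreal (exp (\<Sum>i<N. y i * x i)) \<partial>std_gauss N) = ennreal (exp ((\<Sum>i<N. (y i)\<^sup>2) / 4))"
proof -
  let ?g = "\<lambda>i t. ennreal (exp ((y i)\<^sup>2 / 4) * normal_density (y i / 2) (1 / sqrt 2) t)"
  interpret product_sigma_finite "\<lambda>_ :: nat. lborel :: real measure"
    by standard
  have one: "pi powr (- (1 / 2)) * exp (- t\<^sup>2) * exp (y i * t) = exp ((y i)\<^sup>2 / 4) * normal_density (y i / 2) (1 / sqrt 2) t" for i t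
  proof -
    have "exp (- t\<^sup>2) * exp (y i * t) = exp ((y i)\<^sup>2 / 4) * exp (- ((t - y i / 2)\<^sup>2))"
      unfolding exp_add[symmetric] by (simp add: power2_eq_square algebra_simps)
    moreover have "pi powr (- (1 / 2)) = 1 / sqrt pi" by (simp add: powr_minus powr_half_sqrt inverse_eq_divide)
    ultimately show ?thesis by (simp add: normal_density_def power_divide mult_ac)
  qed
  have "(\<integral>\<^sup>+x. ennreal (exp (\<Sum>i<N. y i * x i)) \<partial>std_gauss N)
    = (\<integral>\<^sup>+x. (\<Prod>i<N. ?g i (x i)) \<partial>(\<Pi>\<^sub>M i\<in>{..<N}. lborel))"
  proof (subst nn_integral_std_gauss, measurable, rule nn_integral_cong)
    fix x :: "nat \<Rightarrow> real"
    have "pi powr (- real N / 2) = (\<Prod>i<N. pi powr (- (1 / 2)))"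
      by (simp add: powr_realpow[symmetric] powr_powr flip: powr_power)
    then have "pi powr (- real N / 2) * exp (- (\<Sum>i<N. (x i)\<^sup>2)) * exp (\<Sum>i<N. y i * x i)
      = (\<Prod>i<N. pi powr (- (1 / 2)) * exp (- (x i)\<^sup>2) * exp (y i * x i))"
      by (simp only: exp_sum[OF finite_lessThan] sum_negf[symmetric] prod.distrib)
    then show "ennreal (pi powr (- real N / 2) * exp (- (\<Sum>i<N. (x i)\<^sup>2))) * ennreal (exp (\<Sum>i<N. y i * x i)) = (\<Prod>i<N. ?g i (x i))"
      unfolding one by (simp add: prod_ennreal flip: ennreal_mult)
  qed
  also have "\<dots> = (\<Prod>i<N. \<integral>\<^sup>+t. ?g i t \<partial>lborel)"
    by (rule product_nn_integral_prod) auto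
  also have "\<dots> = (\<Prod>i<N. ennreal (exp ((y i)\<^sup>2 / 4)))"
  proof (intro prod.cong refl)
    fix i
    have "(\<integral>\<^sup>+t. ennreal (normal_density (y i / 2) (1 / sqrt 2) t) \<partial>lborel) = 1"
      using prob_space.emeasure_space_1[OF prob_space_normal_density[of "1 / sqrt 2" "y i / 2"]]
      by (simp add: emeasure_density)
    then show "(\<integral>\<^sup>+t. ?g i t \<partial>lborel) = ennreal (exp ((y i)\<^sup>2 / 4))"
      by (subst ennreal_mult) (auto simp: nn_integral_cmult)
  qed
  also have "\<dots> = ennreal (exp ((\<Sum>i<N. (y i)\<^sup>2) / 4))"
    by (simp add: prod_ennreal exp_sum sum_divide_distrib)
  finally show ?thesis .
qed

lemma prob_space_std_gauss: "prob_space (std_gauss N)"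
proof
  show "emeasure (std_gauss N) (space (std_gauss N)) = 1"
    using std_gauss_mgf[of N "\<lambda>_. 0"] by simp
qed

text \<open>Exponential Markov inequality: the moment generating function at \<open>l * c\<close> is at most
\<open>exp (l^2 * S^2 / 4)\<close>, and \<open>l = 2 * t / S\<close> minimizes \<open>l^2 * S^2 / 4 - l * t * S\<close>.\<close>

lemma std_gauss_upper_tail:
  assumes S: "(\<Sum>i<N. (c i)\<^sup>2) \<le> S\<^sup>2" "S > 0" and t: "t \<ge> 0"
  shows "measure (std_gauss N) {x \<in> space (std_gauss N). (\<Sum>i<N. c i * x i) > t * S} \<le> exp (- t\<^sup>2)"
proof -
  interpret prob_space "std_gauss N" by (rule prob_space_std_gauss)
  let ?A = "{x \<in> space (std_gauss N). (\<Sum>i<N. c i * x i) > t * S}"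
  define l where "l = 2 * t / S"
  have l: "l \<ge> 0" "l * S = 2 * t" using S t by (auto simp: l_def)
  have [measurable]: "?A \<in> sets (std_gauss N)" by measurable
  have "emeasure (std_gauss N) ?A = (\<integral>\<^sup>+x. indicator ?A x \<partial>std_gauss N)" by simp
  also have "\<dots> \<le> (\<integral>\<^sup>+x. ennreal (exp (- 2 * t\<^sup>2)) * ennreal (exp (\<Sum>i<N. (l * c i) * x i)) \<partial>std_gauss N)"
  proof (intro nn_integral_mono)
    fix x
    have "indicator ?A x \<le> ennreal (exp (- 2 * t\<^sup>2 + (\<Sum>i<N. (l * c i) * x i)))"
    proof (cases "x \<in> ?A")
      case True
      then have "l * (t * S) \<le> l * (\<Sum>i<N. c i * x i)" using l by (intro mult_left_mono) auto
      moreover have "l * (t * S) = 2 * t\<^sup>2" using l(2) by (simp add: power2_eq_square mult.left_commute mult.assoc)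
      ultimately have "0 \<le> - 2 * t\<^sup>2 + (\<Sum>i<N. (l * c i) * x i)"
        by (simp add: sum_distrib_left mult.assoc)
      then show ?thesis using True by (auto simp: indicator_def ennreal_ge_1 one_le_exp_iff simp del: ennreal_1 simp flip: ennreal_1)
    qed auto
    then show "indicator ?A x \<le> ennreal (exp (- 2 * t\<^sup>2)) * ennreal (exp (\<Sum>i<N. (l * c i) * x i))"
      unfolding exp_add by (simp add: ennreal_mult)
  qed
  also have "\<dots> = ennreal (exp (- 2 * t\<^sup>2)) * ennreal (exp ((\<Sum>i<N. (l * c i)\<^sup>2) / 4))"
    by (subst nn_integral_cmult) (auto simp: std_gauss_mgf)
  also have "\<dots> = ennreal (exp (- 2 * t\<^sup>2 + (\<Sum>i<N. (l * c i)\<^sup>2) / 4))"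
    unfolding exp_add by (simp add: ennreal_mult)
  also have "\<dots> \<le> ennreal (exp (- t\<^sup>2))"
  proof -
    have "(\<Sum>i<N. (l * c i)\<^sup>2) = l\<^sup>2 * (\<Sum>i<N. (c i)\<^sup>2)" by (simp add: power_mult_distrib sum_distrib_left)
    also have "\<dots> \<le> l\<^sup>2 * S\<^sup>2" using S by (intro mult_left_mono) auto
    also have "\<dots> = 4 * t\<^sup>2" using l(2) by (simp flip: power_mult_distrib)
    finally show ?thesis by (intro ennreal_leI) auto
  qed
  finally show ?thesis by (simp add: emeasure_eq_measure)
qed

lemma std_gauss_tail:
  assumes S: "(\<Sum>i<N. (c i)\<^sup>2) \<le> S\<^sup>2" "S > 0" and t: "t \<ge> 0"
  shows "measure (std_gauss N) {x \<in> space (std_gauss N). \<bar>\<Sum>i<N. c i * x i\<bar> > t * S} \<le> 2 * exp (- t\<^sup>2)"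
proof -
  interpret prob_space "std_gauss N" by (rule prob_space_std_gauss)
  let ?A = "\<lambda>c. {x \<in> space (std_gauss N). (\<Sum>i<N. c i * x i) > t * S}"
  have [measurable]: "?A c \<in> sets (std_gauss N)" for c by measurable
  have "{x \<in> space (std_gauss N). \<bar>\<Sum>i<N. c i * x i\<bar> > t * S} = ?A c \<union> ?A (\<lambda>i. - c i)"
    by (auto simp: sum_negf abs_real_def)
  then have "prob {x \<in> space (std_gauss N). \<bar>\<Sum>i<N. c i * x i\<bar> > t * S} \<le> prob (?A c) + prob (?A (\<lambda>i. - c i))"
    by (simp add: measure_Un_le)
  also have "\<dots> \<le> exp (- t\<^sup>2) + exp (- t\<^sup>2)"
    using S t by (intro add_mono std_gauss_upper_tail) auto
  finally show ?thesis by simp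
qed

lemma distr_PiM_lborel_translation:
  fixes q :: "'i \<Rightarrow> real"
  assumes "finite I"
  shows "distr (\<Pi>\<^sub>M i\<in>I. lborel) (\<Pi>\<^sub>M i\<in>I. lborel) (\<lambda>x. \<lambda>i\<in>I. x i + q i) = (\<Pi>\<^sub>M i\<in>I. lborel)"
proof -
  interpret product_sigma_finite "\<lambda>_ :: 'i. lborel :: real measure"
    by standard
  show ?thesis
  proof (rule PiM_eqI[OF assms])
    fix A :: "'i \<Rightarrow> real set" assume A: "\<And>i. i \<in> I \<Longrightarrow> A i \<in> sets lborel"
    have [measurable]: "(\<lambda>x. \<lambda>i\<in>I. x i + q i) \<in> (\<Pi>\<^sub>M i\<in>I. lborel) \<rightarrow>\<^sub>M (\<Pi>\<^sub>M i\<in>I. lborel)"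
      by measurable
    have "(\<lambda>x. \<lambda>i\<in>I. x i + q i) -` Pi\<^sub>E I A \<inter> space (\<Pi>\<^sub>M i\<in>I. lborel) = (\<Pi>\<^sub>E i\<in>I. (\<lambda>t. t + q i) -` A i)"
      by (auto simp: space_PiM PiE_iff extensional_def)
    then have "emeasure (distr (\<Pi>\<^sub>M i\<in>I. lborel) (\<Pi>\<^sub>M i\<in>I. lborel) (\<lambda>x. \<lambda>i\<in>I. x i + q i)) (Pi\<^sub>E I A)
       = emeasure (\<Pi>\<^sub>M i\<in>I. lborel) (\<Pi>\<^sub>E i\<in>I. (\<lambda>t. t + q i) -` A i)"
      using A assms by (subst emeasure_distr) (auto intro!: sets_PiM_I_finite)
    also have "\<dots> = (\<Prod>i\<in>I. emeasure lborel ((\<lambda>t. t + q i) -` A i))"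
    proof (rule emeasure_PiM[OF assms])
      fix i assume "i \<in> I"
      then have [measurable]: "A i \<in> sets borel" using A by auto
      have "(\<lambda>t. t + q i) -` A i \<inter> space borel \<in> sets borel" by measurable
      then show "(\<lambda>t. t + q i) -` A i \<in> sets lborel" by simp
    qed
    also have "\<dots> = (\<Prod>i\<in>I. emeasure lborel (A i))"
    proof (intro prod.cong refl)
      fix i assume "i \<in> I"
      have "emeasure lborel (A i) = emeasure (distr lborel borel ((+) (q i))) (A i)"
        by (simp add: lborel_distr_plus)
      also have "\<dots> = emeasure lborel ((\<lambda>t. t + q i) -` A i)"
        using A[OF \<open>i \<in> I\<close>] by (subst emeasure_distr) (auto simp: add.commute intro!: arg_cong[where f="emeasure lborel"])
      finally show "emeasure lborel ((\<lambda>t. t + q i) -` A i) = emeasure lborel (A i)" ..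
    qed
    finally show "emeasure (distr (\<Pi>\<^sub>M i\<in>I. lborel) (\<Pi>\<^sub>M i\<in>I. lborel) (\<lambda>x. \<lambda>i\<in>I. x i + q i)) (Pi\<^sub>E I A) = (\<Prod>i\<in>I. emeasure lborel (A i))" .
  qed simp
qed

text \<open>Cameron-Martin shift. Translating by \<open>q\<close> changes the density at \<open>x\<close> by the factor
\<open>exp (- |q|^2 - 2 * (q \<bullet> x))\<close>, which is bounded below on \<open>B\<close>.\<close>

lemma std_gauss_translation:
  assumes A: "A \<in> sets (std_gauss N)" and B: "B \<in> sets (std_gauss N)"
    and AB: "\<And>x. x \<in> B \<Longrightarrow> (\<lambda>i\<in>{..<N}. x i + q i) \<in> A"
    and K: "\<And>x. x \<in> B \<Longrightarrow> (\<Sum>i<N. q i * x i) \<le> K"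
  shows "exp (- (\<Sum>i<N. (q i)\<^sup>2) - 2 * K) * measure (std_gauss N) B \<le> measure (std_gauss N) A"
proof -
  interpret prob_space "std_gauss N" by (rule prob_space_std_gauss)
  let ?L = "\<Pi>\<^sub>M i\<in>{..<N}. lborel :: real measure"
  let ?tau = "\<lambda>x. \<lambda>i\<in>{..<N}. x i + q i"
  let ?phi = "\<lambda>x. pi powr (- real N / 2) * exp (- (\<Sum>i<N. (x i)\<^sup>2))"
  let ?C = "exp (- (\<Sum>i<N. (q i)\<^sup>2) - 2 * K)"
  have [measurable]: "A \<in> sets ?L" "B \<in> sets ?L" "A \<in> sets (\<Pi>\<^sub>M i\<in>{..<N}. borel)" "B \<in> sets (\<Pi>\<^sub>M i\<in>{..<N}. borel)"
    using A B by (simp_all add: std_gauss_def sets_std_gauss cong: sets_PiM_cong)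
  have [measurable]: "?tau \<in> ?L \<rightarrow>\<^sub>M ?L" by measurable
  have "ennreal (?C * prob B) = ennreal ?C * emeasure (std_gauss N) B"
    by (simp add: emeasure_eq_measure ennreal_mult)
  also have "emeasure (std_gauss N) B = (\<integral>\<^sup>+x. indicator B x \<partial>std_gauss N)"
    using B by simp
  also have "\<dots> = (\<integral>\<^sup>+x. ennreal (?phi x) * indicator B x \<partial>?L)"
    by (rule nn_integral_std_gauss) measurable
  also have "ennreal ?C * \<dots> = (\<integral>\<^sup>+x. ennreal ?C * (ennreal (?phi x) * indicator B x) \<partial>?L)"
    by (subst nn_integral_cmult) auto
  also have "\<dots> \<le> (\<integral>\<^sup>+x. ennreal (?phi (?tau x)) * indicator A (?tau x) \<partial>?L)"
  proof (intro nn_integral_mono)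
    fix x
    show "ennreal ?C * (ennreal (?phi x) * indicator B x) \<le> ennreal (?phi (?tau x)) * indicator A (?tau x)"
    proof (cases "x \<in> B")
      case True
      have "(\<Sum>i<N. (x i + q i)\<^sup>2) = (\<Sum>i<N. (x i)\<^sup>2) + (\<Sum>i<N. (q i)\<^sup>2) + 2 * (\<Sum>i<N. q i * x i)"
        unfolding sum_distrib_left sum.distrib[symmetric]
        by (intro sum.cong refl) (simp add: power2_eq_square algebra_simps)
      then have "- (\<Sum>i<N. (q i)\<^sup>2) - 2 * K + - (\<Sum>i<N. (x i)\<^sup>2) \<le> - (\<Sum>i<N. (x i + q i)\<^sup>2)"
        using K[OF True] by simp
      then have "?C * exp (- (\<Sum>i<N. (x i)\<^sup>2)) \<le> exp (- (\<Sum>i<N. (x i + q i)\<^sup>2))"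
        unfolding exp_add[symmetric] by simp
      then have "?C * ?phi x \<le> pi powr (- real N / 2) * exp (- (\<Sum>i<N. (x i + q i)\<^sup>2))"
        by (simp add: mult.left_commute)
      then show ?thesis using True AB[OF True] by (simp add: ennreal_leI flip: ennreal_mult)
    qed auto
  qed
  also have "\<dots> = (\<integral>\<^sup>+y. ennreal (?phi y) * indicator A y \<partial>distr ?L ?L ?tau)"
    by (subst nn_integral_distr) auto
  also have "\<dots> = (\<integral>\<^sup>+y. indicator A y \<partial>std_gauss N)"
    unfolding distr_PiM_lborel_translation[OF finite_lessThan] by (rule nn_integral_std_gauss[symmetric]) measurable
  also have "\<dots> = ennreal (prob A)" using A by (simp add: emeasure_eq_measure)
  finally show ?thesis by (simp add: ennreal_le_iff)
qed

section \<open>The Kostlan measure in orthonormal coordinates\<close>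

lemma hpoly_eval_combination:
  fixes X :: "real ^ 3"
  shows "hpoly_eval d (\<lambda>a\<in>monoms d. \<Sum>i<n. x i * b i a) X = (\<Sum>i<n. x i * hpoly_eval d (b i) X)"
proof -
  have "hpoly_eval d (\<lambda>a\<in>monoms d. \<Sum>i<n. x i * b i a) X
    = (\<Sum>a\<in>monoms d. \<Sum>i<n. x i * (b i a * (case a of (i, j, k) \<Rightarrow> X $ 1 ^ i * X $ 2 ^ j * X $ 3 ^ k)))"
    unfolding hpoly_eval_real by (intro sum.cong refl) (simp add: sum_distrib_right mult.assoc)
  also have "\<dots> = (\<Sum>i<n. x i * hpoly_eval d (b i) X)"
    unfolding hpoly_eval_real sum_distrib_left by (rule sum.swap)
  finally show ?thesis .
qed

lemma l2_norm_sq_combination: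
  assumes "orthonormal_basis d b"
  shows "l2_norm_sq d (\<lambda>a\<in>monoms d. \<Sum>i<dim_hpolys d. x i * b i a) = (\<Sum>i<dim_hpolys d. (x i)\<^sup>2)"
proof -
  let ?N = "dim_hpolys d"
  have "l2_norm_sq d (\<lambda>a\<in>monoms d. \<Sum>i<?N. x i * b i a)
     = (\<Sum>a\<in>monoms d. \<Sum>i<?N. \<Sum>j<?N. x i * x j * (l2_weight a * (b i a * b j a)))"
    unfolding l2_norm_sq_eq
  proof (intro sum.cong refl)
    fix a assume "a \<in> monoms d"
    then have "l2_weight a * ((\<lambda>a\<in>monoms d. \<Sum>i<?N. x i * b i a) a)\<^sup>2 = l2_weight a * ((\<Sum>i<?N. x i * b i a) * (\<Sum>j<?N. x j * b j a))"
      by (simp add: power2_eq_square)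
    also have "\<dots> = (\<Sum>i<?N. \<Sum>j<?N. x i * x j * (l2_weight a * (b i a * b j a)))"
      unfolding sum_product by (simp only: sum_distrib_left) (intro sum.cong refl, simp only: mult_ac)
    finally show "l2_weight a * ((\<lambda>a\<in>monoms d. \<Sum>i<?N. x i * b i a) a)\<^sup>2 = \<dots>" .
  qed
  also have "\<dots> = (\<Sum>i<?N. \<Sum>j<?N. \<Sum>a\<in>monoms d. x i * x j * (l2_weight a * (b i a * b j a)))"
    by (subst sum.swap, intro sum.cong refl sum.swap)
  also have "\<dots> = (\<Sum>i<?N. \<Sum>j<?N. if i = j then (x i)\<^sup>2 else 0)"
    unfolding sum_distrib_left[symmetric] l2_inner_eq[symmetric] using assms
    by (intro sum.cong refl) (auto simp: orthonormal_basis_def power2_eq_square)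
  also have "\<dots> = (\<Sum>i<?N. (x i)\<^sup>2)" by (simp add: sum.delta)
  finally show ?thesis .
qed

text \<open>In the orthonormal basis chosen in the definition of the Lebesgue measure the \<open>L\<^sup>2\<close> norm is the
Euclidean norm of the coordinates, so the density pulls back to the Gaussian one.\<close>

lemma kostlan_eq_distr:
  obtains b where "orthonormal_basis d b"
    and "kostlan d = distr (std_gauss (dim_hpolys d)) (\<Pi>\<^sub>M a\<in>monoms d. borel)
        (\<lambda>x. \<lambda>a\<in>monoms d. \<Sum>i<dim_hpolys d. x i * b i a)"
proof -
  let ?N = "dim_hpolys d"
  define b where "b = (SOME b. orthonormal_basis d b)"
  have b: "orthonormal_basis d b" unfolding b_def using orthonormal_basis_exists by (rule someI_ex)
  have [measurable]: "(\<lambda>P. l2_norm_sq d P) \<in> borel_measurable (\<Pi>\<^sub>M a\<in>monoms d. borel)"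
    unfolding l2_norm_sq_eq by measurable
  have [measurable]: "(\<lambda>x. \<lambda>a\<in>monoms d. \<Sum>i<?N. x i * b i a) \<in> (\<Pi>\<^sub>M i\<in>{..<?N}. lborel) \<rightarrow>\<^sub>M (\<Pi>\<^sub>M a\<in>monoms d. borel)"
    by measurable
  have "kostlan d = distr (std_gauss ?N) (\<Pi>\<^sub>M a\<in>monoms d. borel) (\<lambda>x. \<lambda>a\<in>monoms d. \<Sum>i<?N. x i * b i a)"
    unfolding kostlan_def lebesgue_hpolys_def Let_def b_def[symmetric] std_gauss_def
    by (subst density_distr) (auto simp: l2_norm_sq_combination[OF b])
  with b show ?thesis by (rule that)
qed

section \<open>Components of the complement of a real curve\<close>

lemma proj_pt_eq_iff:
  assumes "v \<noteq> 0" "w \<noteq> 0"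
  shows "proj_pt v = proj_pt w \<longleftrightarrow> (\<exists>c. w = c *\<^sub>R v)"
  using Quotient3_rel[OF Quotient3_rp2, of v w] assms
  by (auto intro: exI[of _ 1])

lemma proj_pt_scaleR: "c \<noteq> 0 \<Longrightarrow> v \<noteq> 0 \<Longrightarrow> proj_pt (c *\<^sub>R v) = proj_pt v"
  using proj_pt_eq_iff[of v "c *\<^sub>R v"] by auto

lemma proj_pt_uminus: "v \<noteq> 0 \<Longrightarrow> proj_pt (- v) = proj_pt v"
  using proj_pt_scaleR[of "-1" v] by simp

lemma proj_pt_unit_representative: obtains v where "norm v = 1" "proj_pt v = p"
proof -
  obtain w where w: "w \<noteq> 0" "proj_pt w = p"
    using Quotient3_abs_rep[OF Quotient3_rp2, of p] Quotient3_rep_reflp[OF Quotient3_rp2, of p] by auto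
  show ?thesis
    using w by (intro that[of "(1 / norm w) *\<^sub>R w"]) (auto simp: proj_pt_scaleR)
qed

lemma fs_dist_proj_pt:
  assumes "norm v = 1" "norm w = 1"
  shows "fs_dist (proj_pt v) (proj_pt w) = arccos \<bar>v \<bullet> w\<bar>"
proof -
  have "v \<noteq> 0" "w \<noteq> 0" using assms by auto
  then show ?thesis
    using assms by (subst fs_dist.abs_eq) (auto intro: exI[of _ 1])
qed

lemma continuous_on_proj_pt: "continuous_on (- {0}) proj_pt"
proof -
  have "open (proj_pt -` B \<inter> - {0})" if "open B" for B
  proof -
    have "proj_pt -` B \<inter> - {0} = {v. v \<noteq> 0 \<and> proj_pt v \<in> B}" by auto
    then show ?thesis using that by (simp add: open_rp2_def)
  qed
  then show ?thesis by (subst continuous_on_open_vimage) auto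
qed

lemma open_image_proj_pt:
  assumes "open U" "0 \<notin> U"
  shows "open (proj_pt ` U)"
proof -
  have nz: "\<And>x. x \<in> U \<Longrightarrow> x \<noteq> 0" using assms by auto
  have "{v. v \<noteq> 0 \<and> proj_pt v \<in> proj_pt ` U} = (\<Union>c\<in>- {0}. (\<lambda>x. c *\<^sub>R x) ` U)" (is "?L = ?R")
  proof safe
    fix v u assume "v \<noteq> 0" "u \<in> U" "proj_pt v = proj_pt u"
    then obtain c where "v = c *\<^sub>R u" using proj_pt_eq_iff[of u v] nz by auto
    then show "v \<in> ?R" using \<open>v \<noteq> 0\<close> \<open>u \<in> U\<close> by auto
  next
    fix c :: real and u assume "c \<noteq> 0" "u \<in> U"
    then show "proj_pt (c *\<^sub>R u) \<in> proj_pt ` U" using nz by (auto simp: proj_pt_scaleR)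
  qed (use nz in auto)
  moreover have "open ?R" using assms by (intro open_UN ballI open_scaling) auto
  ultimately show ?thesis by (simp add: open_rp2_def)
qed

lemma hpoly_eval_scaleR:
  fixes v :: "real ^ 3"
  shows "hpoly_eval d P (c *\<^sub>R v) = c ^ d * hpoly_eval d P v"
  unfolding hpoly_eval_real sum_distrib_left
  by (intro sum.cong refl) (auto simp: monoms_def power_mult_distrib power_add mult_ac)

lemma hpoly_eval_zero: "d \<ge> 1 \<Longrightarrow> hpoly_eval d P (0 :: real ^ 3) = 0"
  using hpoly_eval_scaleR[of d P 0 0] by (simp add: power_0_left)

lemma hpoly_eval_uminus_eq_0: "hpoly_eval d P (- v :: real ^ 3) = 0 \<longleftrightarrow> hpoly_eval d P v = 0"
  using hpoly_eval_scaleR[of d P "-1" v] by simp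

lemma continuous_on_hpoly_eval [continuous_intros]: "continuous_on S (\<lambda>v :: real ^ 3. hpoly_eval d P v)"
  unfolding hpoly_eval_real split_beta by (intro continuous_intros)

text \<open>The preimage in \<open>\<real>\<^sup>3\<close> of the complement of the curve. Working with it avoids path lifting and
local path-connectedness of the projective plane.\<close>

definition nonzero_cone :: "nat \<Rightarrow> hpoly \<Rightarrow> (real ^ 3) set" where
  "nonzero_cone d P = {v. hpoly_eval d P v \<noteq> 0}"

lemma open_nonzero_cone: "open (nonzero_cone d P)"
  unfolding nonzero_cone_def by (intro open_Collect_neq continuous_intros)

lemma proj_pt_in_complement:
  assumes "v \<noteq> 0"
  shows "proj_pt v \<in> - real_curve d P \<longleftrightarrow> v \<in> nonzero_cone d P"
proof -
  have "hpoly_eval d P v = 0" if "w \<noteq> 0" "hpoly_eval d P w = 0" "proj_pt v = proj_pt w" for w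
    using proj_pt_eq_iff[of w v] that assms by (auto simp: hpoly_eval_scaleR)
  then show ?thesis using assms by (auto simp: real_curve_def nonzero_cone_def)
qed

text \<open>The set \<open>nonzero_cone d P\<close> is open and invariant under nonzero scalars, positive ones preserving each of
its components. If \<open>C\<close> is the component of \<open>v\<close>, the images of \<open>C\<close> and of the points outside
\<open>C\<close> and \<open>- C\<close> are disjoint, open, and cover the complement of the curve, so a connected set through
\<open>proj_pt v\<close> stays in the image of \<open>C\<close>.\<close>

lemma connected_component_complement_iff:
  assumes d: "d \<ge> 1" and vw: "v \<noteq> 0" "w \<noteq> 0"
  shows "connected_component (- real_curve d P) (proj_pt v) (proj_pt w) \<longleftrightarrow>
     connected_component (nonzero_cone d P) v w \<or> connected_component (nonzero_cone d P) v (- w)"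
proof
  let ?S = "- real_curve d P" and ?U = "nonzero_cone d P"
  have U0: "0 \<notin> ?U" using hpoly_eval_zero[OF d] by (simp add: nonzero_cone_def)
  have down: "connected_component ?S (proj_pt v) (proj_pt x)" if vx: "connected_component ?U v x" for x
  proof -
    obtain T where T: "connected T" "T \<subseteq> ?U" "v \<in> T" "x \<in> T"
      using vx by (auto simp: connected_component_def)
    have "continuous_on T proj_pt"
      using T U0 by (intro continuous_on_subset[OF continuous_on_proj_pt]) auto
    then have "connected (proj_pt ` T)" using T by (intro connected_continuous_image)
    moreover have "proj_pt ` T \<subseteq> ?S"
    proof
      fix y assume "y \<in> proj_pt ` T"
      then obtain x where "x \<in> T" "y = proj_pt x" by auto
      moreover have "x \<noteq> 0" using T U0 \<open>x \<in> T\<close> by auto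
      ultimately show "y \<in> ?S" using T proj_pt_in_complement by auto
    qed
    ultimately show ?thesis using T unfolding connected_component_def by blast
  qed
  {
    assume "connected_component ?U v w \<or> connected_component ?U v (- w)"
    then show "connected_component ?S (proj_pt v) (proj_pt w)"
      using down[of w] down[of "- w"] vw by (auto simp: proj_pt_uminus)
  }
  assume "connected_component ?S (proj_pt v) (proj_pt w)"
  then obtain T where T: "connected T" "T \<subseteq> ?S" "proj_pt v \<in> T" "proj_pt w \<in> T"
    by (auto simp: connected_component_def)
  define C where "C = connected_component_set ?U v"
  have vU: "v \<in> ?U" and wU: "w \<in> ?U" using T proj_pt_in_complement vw by auto
  have C: "open C" "connected C" "C \<subseteq> ?U" "v \<in> C"
    unfolding C_def using vU connected_component_subset[of ?U v]
    by (auto intro: open_connected_component open_nonzero_cone)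
  define C2 where "C2 = {x \<in> ?U. x \<notin> C \<and> - x \<notin> C}"
  have conn: "x \<in> C \<longleftrightarrow> y \<in> C" if "connected_component ?U x y" for x y
    using that unfolding C_def by (metis connected_component_eq connected_component_sym connected_component_trans mem_Collect_eq)
  have neg: "connected_component ?U (- x) (- y)" if xy: "connected_component ?U x y" for x y
  proof -
    obtain T where "connected T" "T \<subseteq> ?U" "x \<in> T" "y \<in> T"
      using xy by (auto simp: connected_component_def)
    then show ?thesis unfolding connected_component_def
      by (intro exI[of _ "uminus ` T"])
        (auto intro!: connected_continuous_image continuous_intros simp: nonzero_cone_def hpoly_eval_uminus_eq_0)
  qed
  have "C2 = (\<Union>x\<in>C2. connected_component_set ?U x)"
  proof (intro equalityI subsetI)
    fix y assume "y \<in> (\<Union>x\<in>C2. connected_component_set ?U x)"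
    then obtain x where x: "x \<in> C2" "connected_component ?U x y" by auto
    then show "y \<in> C2"
      using conn[OF x(2)] conn[OF neg[OF x(2)]] connected_component_in[OF x(2)] by (auto simp: C2_def)
  qed (auto simp: C2_def)
  moreover have "open (\<Union>x\<in>C2. connected_component_set ?U x)"
    by (intro open_UN ballI open_connected_component open_nonzero_cone)
  ultimately have "open C2" by simp
  \<comment> \<open>The ray through a point of \<open>C\<close> lies in \<open>C\<close>, so a point with the same image as a point of \<open>C\<close> is in \<open>C\<close> up to sign.\<close>
  have cone: "x \<in> C \<or> - x \<in> C" if x: "x \<in> ?U" and y: "y \<in> C" "proj_pt x = proj_pt y" for x y
  proof -
    have "x \<noteq> 0" "y \<noteq> 0" using x y C U0 by auto
    then obtain c where c: "x = c *\<^sub>R y" using y proj_pt_eq_iff[of y x] by auto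
    have "c \<noteq> 0" using c \<open>x \<noteq> 0\<close> by auto
    have "\<bar>c\<bar> *\<^sub>R y \<in> C"
    proof -
      have "closed_segment y (\<bar>c\<bar> *\<^sub>R y) \<subseteq> ?U"
      proof
        fix z assume "z \<in> closed_segment y (\<bar>c\<bar> *\<^sub>R y)"
        then obtain t where t: "0 \<le> t" "t \<le> 1" "z = (1 - t + t * \<bar>c\<bar>) *\<^sub>R y"
          by (auto simp: in_segment algebra_simps)
        have "1 - t + t * \<bar>c\<bar> > 0"
          using t \<open>c \<noteq> 0\<close> by (cases "t = 0") (auto simp: add_nonneg_pos)
        then show "z \<in> ?U" using y C t by (auto simp: nonzero_cone_def hpoly_eval_scaleR)
      qed
      then have "connected_component ?U y (\<bar>c\<bar> *\<^sub>R y)"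
        unfolding connected_component_def
        by (intro exI[of _ "closed_segment y (\<bar>c\<bar> *\<^sub>R y)"]) auto
      then show ?thesis using conn y by blast
    qed
    then show ?thesis unfolding c by (cases "c \<ge> 0") (auto simp: abs_real_def)
  qed
  have "T \<subseteq> proj_pt ` C \<union> proj_pt ` C2"
  proof
    fix p assume "p \<in> T"
    obtain x where x: "norm x = 1" "proj_pt x = p" by (rule proj_pt_unit_representative)
    then have "x \<noteq> 0" by auto
    then have "x \<in> ?U" "- x \<in> ?U"
      using x \<open>p \<in> T\<close> T(2) proj_pt_in_complement[of x d P] by (auto simp: nonzero_cone_def hpoly_eval_uminus_eq_0)
    then have "x \<in> C \<or> - x \<in> C \<or> x \<in> C2" by (auto simp: C2_def)
    then show "p \<in> proj_pt ` C \<union> proj_pt ` C2"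
      using x proj_pt_uminus[OF \<open>x \<noteq> 0\<close>] by (auto simp: image_iff) metis
  qed
  moreover have "proj_pt ` C \<inter> proj_pt ` C2 \<inter> T = {}"
    using cone by (auto simp: C2_def) metis
  moreover have "open (proj_pt ` C)" "open (proj_pt ` C2)"
    using \<open>open C\<close> \<open>open C2\<close> C U0 by (auto intro!: open_image_proj_pt simp: C2_def)
  moreover have "proj_pt ` C \<inter> T \<noteq> {}" using C T by auto
  ultimately have "proj_pt ` C2 \<inter> T = {}"
    using connectedD[OF T(1), of "proj_pt ` C" "proj_pt ` C2"] by auto
  then have "w \<notin> C2" using T by auto
  then have "w \<in> C \<or> - w \<in> C" using wU by (auto simp: C2_def)
  then show "connected_component ?U v w \<or> connected_component ?U v (- w)" by (simp add: C_def)
qed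

text \<open>Two points in one component are joined by a path on which \<open>\<bar>P\<bar>\<close> is bounded below; a small
change of the coefficients keeps the polynomial nonzero along the same path.\<close>

lemma open_polynomials_connecting:
  "open {P :: hpoly. connected_component (nonzero_cone d P) v w}"
proof (subst open_subopen, rule ballI)
  fix P :: hpoly assume "P \<in> {P. connected_component (nonzero_cone d P) v w}"
  then have "path_component (nonzero_cone d P) v w"
    by (simp add: open_path_connected_component[OF open_nonzero_cone])
  then obtain g where g: "path g" "path_image g \<subseteq> nonzero_cone d P" "pathstart g = v" "pathfinish g = w"
    by (auto simp: path_component_def)
  define K where "K = path_image g"
  have K: "compact K" "connected K" "v \<in> K" "w \<in> K" "K \<noteq> {}"
    using g unfolding K_def by (auto intro: compact_path_image connected_path_image)
  define M where "M = (\<lambda>(i, j, k) (X :: real ^ 3). X $ 1 ^ i * X $ 2 ^ j * X $ 3 ^ k)"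
  have cont: "continuous_on K (\<lambda>X. M a X)" for a
    unfolding M_def split_beta by (intro continuous_intros)
  obtain u where u: "u \<in> K" "\<And>y. y \<in> K \<Longrightarrow> \<bar>hpoly_eval d P u\<bar> \<le> \<bar>hpoly_eval d P y\<bar>"
    using continuous_attains_inf[OF K(1) K(5), of "\<lambda>v. \<bar>hpoly_eval d P v\<bar>"] by (auto intro: continuous_intros)
  define \<delta> where "\<delta> = \<bar>hpoly_eval d P u\<bar>"
  have \<delta>: "\<delta> > 0" using u g unfolding \<delta>_def K_def nonzero_cone_def by auto
  obtain u' where u': "\<And>y. y \<in> K \<Longrightarrow> (\<Sum>a\<in>monoms d. \<bar>M a y\<bar>) \<le> (\<Sum>a\<in>monoms d. \<bar>M a u'\<bar>)"
  proof -
    have "continuous_on K (\<lambda>v. \<Sum>a\<in>monoms d. \<bar>M a v\<bar>)" by (intro continuous_intros cont)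
    from continuous_attains_sup[OF K(1) K(5) this] show ?thesis using that by blast
  qed
  define B where "B = (\<Sum>a\<in>monoms d. \<bar>M a u'\<bar>)"
  have B: "B \<ge> 0" unfolding B_def by (intro sum_nonneg) auto
  define O' where "O' = (\<Inter>a\<in>monoms d. {Q :: hpoly. \<bar>Q a - P a\<bar> < \<delta> / (B + 1)})"
  have "open O'"
    unfolding O'_def by (intro open_INT finite_monoms ballI open_Collect_less continuous_intros continuous_on_product_coordinates)
  moreover have "P \<in> O'" using \<delta> B by (auto simp: O'_def)
  moreover have "O' \<subseteq> {P. connected_component (nonzero_cone d P) v w}"
  proof (intro subsetI CollectI)
    fix Q assume "Q \<in> O'"
    then have Q: "\<bar>Q a - P a\<bar> \<le> \<delta> / (B + 1)" if "a \<in> monoms d" for a using that by (force simp: O'_def)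
    have "hpoly_eval d Q y \<noteq> 0" if y: "y \<in> K" for y
    proof -
      have "\<bar>hpoly_eval d Q y - hpoly_eval d P y\<bar> = \<bar>\<Sum>a\<in>monoms d. (Q a - P a) * M a y\<bar>"
        unfolding hpoly_eval_real M_def sum_subtractf[symmetric] by (simp add: left_diff_distrib split_beta)
      also have "\<dots> \<le> (\<Sum>a\<in>monoms d. \<delta> / (B + 1) * \<bar>M a y\<bar>)"
        using Q by (intro order_trans[OF sum_abs] sum_mono) (simp only: abs_mult, intro mult_right_mono, auto)
      also have "\<dots> \<le> \<delta> / (B + 1) * B"
        unfolding sum_distrib_left[symmetric] B_def[symmetric] using u'[OF y] \<delta> B by (intro mult_left_mono) (auto simp: B_def)
      also have "\<dots> < \<delta>" using \<delta> B by (simp add: field_simps)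
      finally show ?thesis using u(2)[OF y] by (auto simp: \<delta>_def)
    qed
    then have "K \<subseteq> nonzero_cone d Q" by (auto simp: nonzero_cone_def)
    then show "connected_component (nonzero_cone d Q) v w"
      using K unfolding connected_component_def by blast
  qed
  ultimately show "\<exists>T. open T \<and> P \<in> T \<and> T \<subseteq> {P. connected_component (nonzero_cone d P) v w}" by blast
qed

lemma in_different_components_iff:
  "in_different_components I p S \<longleftrightarrow>
    (\<forall>i\<in>I. p i \<in> S) \<and> (\<forall>i\<in>I. \<forall>j\<in>I. i \<noteq> j \<longrightarrow> \<not> connected_component S (p i) (p j))" (is "?l \<longleftrightarrow> ?r")
proof
  assume ?l
  then obtain C where C: "inj_on C I" "\<And>i. i \<in> I \<Longrightarrow> C i \<in> components S \<and> p i \<in> C i"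
    by (auto simp: in_different_components_def)
  have eq: "C i = connected_component_set S (p i)" if i: "i \<in> I" for i
  proof -
    obtain x where "C i = connected_component_set S x" "p i \<in> C i"
      using C(2)[OF i] by (auto simp: components_iff)
    then show ?thesis by (metis connected_component_eq)
  qed
  have "p i \<in> S" if "i \<in> I" for i
    using C(2)[OF that] in_components_subset by blast
  moreover have "i = j" if "i \<in> I" "j \<in> I" "connected_component S (p i) (p j)" for i j
  proof -
    have "C i = C j" unfolding eq[OF that(1)] eq[OF that(2)]
      by (rule connected_component_eq[symmetric]) (use that(3) in simp)
    then show ?thesis using C(1) that by (auto dest: inj_onD)
  qed
  ultimately show ?r by blast
next
  assume r: ?r
  then have refl: "connected_component S (p i) (p i)" if "i \<in> I" for i using that by simp
  have "inj_on (\<lambda>i. connected_component_set S (p i)) I"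
    using r refl by (intro inj_onI) (metis mem_Collect_eq)
  then show ?l
    using r refl unfolding in_different_components_def by (intro exI[of _ "\<lambda>i. connected_component_set S (p i)"]) (auto simp: components_def)
qed

text \<open>The event is a Boolean combination of the closed conditions that \<open>P\<close> vanishes at \<open>v i\<close> and of the
open conditions that \<open>P\<close> connects \<open>v i\<close> with \<open>v j\<close> or \<open>- v j\<close>. Without measurability the
event would have probability \<open>0\<close> by convention.\<close>

lemma measurable_in_different_components:
  assumes d: "d \<ge> 1" and "finite I"
  shows "{P \<in> space (\<Pi>\<^sub>M a\<in>monoms d. borel). in_different_components I p (- real_curve d P)} \<in> sets (\<Pi>\<^sub>M a\<in>monoms d. borel :: real measure)"
proof -
  let ?M = "\<Pi>\<^sub>M a\<in>monoms d. borel :: real measure"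
  have "\<forall>i. \<exists>v. norm v = 1 \<and> proj_pt v = p i" using proj_pt_unit_representative by metis
  then obtain v where v: "\<And>i. norm (v i) = 1" "\<And>i. proj_pt (v i) = p i" by metis
  have v0: "v i \<noteq> 0" for i using v(1)[of i] by auto
  have "(\<lambda>P. P) \<in> ?M \<rightarrow>\<^sub>M (\<Pi>\<^sub>M a\<in>UNIV. borel)"
  proof (rule measurable_PiM_single')
    fix a :: "nat \<times> nat \<times> nat"
    show "(\<lambda>P. P a) \<in> ?M \<rightarrow>\<^sub>M borel"
    proof (cases "a \<in> monoms d")
      case False
      have "(\<lambda>P. undefined) \<in> ?M \<rightarrow>\<^sub>M borel" by simp
      moreover have "P a = undefined" if "P \<in> space ?M" for P
        using that False by (cases a) (auto simp: space_PiM PiE_def extensional_def)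
      ultimately show ?thesis by (subst measurable_cong[where g="\<lambda>P. undefined"]) auto
    qed measurable
  qed auto
  \<comment> \<open>Extensional families are constant outside the monomials, so the inclusion into all functions is measurable.\<close>
  then have id [measurable]: "(\<lambda>P. P) \<in> ?M \<rightarrow>\<^sub>M borel"
    by (simp cong: measurable_cong_sets add: sets_PiM_equal_borel)
  have [measurable]: "Measurable.pred ?M (\<lambda>P. connected_component (nonzero_cone d P) x y)" for x y
  proof -
    have "{P. connected_component (nonzero_cone d P) x y} \<in> sets borel"
      using open_polynomials_connecting by (rule borel_open)
    from measurable_sets[OF id this] show ?thesis by (simp add: pred_def vimage_def Int_def conj_commute)
  qed
  have [measurable]: "Measurable.pred ?M (\<lambda>P. v i \<in> nonzero_cone d P)" for i
    unfolding nonzero_cone_def hpoly_eval_real mem_Collect_eq by measurable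
  have "in_different_components I p (- real_curve d P) \<longleftrightarrow> (\<forall>i\<in>I. v i \<in> nonzero_cone d P) \<and> (\<forall>i\<in>I. \<forall>j\<in>I. i \<noteq> j \<longrightarrow>
      \<not> (connected_component (nonzero_cone d P) (v i) (v j) \<or> connected_component (nonzero_cone d P) (v i) (- v j)))" for P
    unfolding in_different_components_iff v(2)[symmetric] proj_pt_in_complement[OF v0] connected_component_complement_iff[OF d v0 v0] ..
  then show ?thesis using assms(2) by simp
qed

text \<open>The condition \<open>d * (x \<bullet> x) < (d + 1) * (x \<bullet> v)\<^sup>2\<close> with \<open>x \<bullet> v > 0\<close> describes an open round cone
around \<open>v\<close>. Every nonzero point of its boundary is a positive multiple of a point \<open>u\<close> where \<open>P\<close> is assumed positive,
so the part of the cone where \<open>P < 0\<close> is both open and closed in \<open>nonzero_cone d P\<close>.\<close>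

lemma sign_change_separates:
  fixes v w :: "real ^ 3"
  assumes d: "d \<ge> 1" and neg: "hpoly_eval d P v < 0" and v: "norm v = 1"
    and pos: "\<And>u. u \<bullet> v = 1 \<Longrightarrow> u \<bullet> u = 1 + 1 / real d \<Longrightarrow> hpoly_eval d P u > 0"
    and w: "(real d + 1) * (w \<bullet> v)\<^sup>2 \<le> real d * (w \<bullet> w)"
  shows "\<not> connected_component (nonzero_cone d P) v w"
proof
  assume "connected_component (nonzero_cone d P) v w"
  then obtain T where T: "connected T" "T \<subseteq> nonzero_cone d P" "v \<in> T" "w \<in> T"
    by (auto simp: connected_component_def)
  define A where "A = {x. hpoly_eval d P x < 0} \<inter> {x. x \<bullet> v > 0} \<inter> {x. real d * (x \<bullet> x) < (real d + 1) * (x \<bullet> v)\<^sup>2}"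
  define B where "B = {x. hpoly_eval d P x > 0} \<union> {x. x \<bullet> v < 0} \<union> {x. real d * (x \<bullet> x) > (real d + 1) * (x \<bullet> v)\<^sup>2}"
  have "open A" unfolding A_def by (intro open_Int open_Collect_less continuous_intros)
  moreover have "open B" unfolding B_def by (intro open_Un open_Collect_less continuous_intros)
  moreover have "A \<inter> B \<inter> T = {}" by (auto simp: A_def B_def)
  moreover have "T \<subseteq> A \<union> B"
  proof
    fix x assume x: "x \<in> T"
    have Px: "hpoly_eval d P x \<noteq> 0" using x T by (auto simp: nonzero_cone_def)
    show "x \<in> A \<union> B"
    proof (rule ccontr)
      assume nAB: "x \<notin> A \<union> B"
      have 1: "x \<bullet> v \<ge> 0" "real d * (x \<bullet> x) \<le> (real d + 1) * (x \<bullet> v)\<^sup>2" and 2: "hpoly_eval d P x < 0"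
        using nAB Px by (auto simp: B_def)
      have "x \<noteq> 0" using Px hpoly_eval_zero[OF d, of P] by auto
      then have "x \<bullet> x > 0" by simp
      have "x \<bullet> v \<noteq> 0"
      proof
        assume "x \<bullet> v = 0"
        then have "real d * (x \<bullet> x) \<le> 0" using 1 by simp
        moreover have "real d * (x \<bullet> x) > 0" using d \<open>x \<bullet> x > 0\<close> by simp
        ultimately show False by simp
      qed
      then have t: "x \<bullet> v > 0" using 1 by simp
      then have eq: "real d * (x \<bullet> x) = (real d + 1) * (x \<bullet> v)\<^sup>2"
        using nAB 1 2 by (auto simp: A_def)
      define u where "u = (1 / (x \<bullet> v)) *\<^sub>R x"
      have "u \<bullet> v = 1" using t by (simp add: u_def)
      moreover have "u \<bullet> u = 1 + 1 / real d"
      proof -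
        have "u \<bullet> u = (x \<bullet> x) / (x \<bullet> v)\<^sup>2" using t by (simp add: u_def power2_eq_square)
        also have "\<dots> = (real d + 1) / real d" using eq t d by (simp add: divide_simps mult_ac)
        finally show ?thesis using d by (simp add: field_simps)
      qed
      ultimately have "hpoly_eval d P u > 0" by (rule pos)
      moreover have "hpoly_eval d P x = (x \<bullet> v) ^ d * hpoly_eval d P u"
        using t hpoly_eval_scaleR[of d P "x \<bullet> v" u] by (simp add: u_def)
      ultimately show False using 2 mult_pos_pos[OF zero_less_power[OF t, of d]] by force
    qed
  qed
  moreover have "A \<inter> T \<noteq> {}"
    using T(3) neg v by (auto simp: A_def dot_square_norm)
  moreover have "w \<notin> A" using w by (auto simp: A_def)
  ultimately show False using connectedD[OF T(1), of A B] T(4) by auto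
qed

section \<open>Small circles around points of the sphere\<close>

lemma sin_ge_half:
  fixes x :: real assumes "0 \<le> x" "x \<le> pi / 3"
  shows "x / 2 \<le> sin x"
proof (cases "x = 0")
  case False
  then have "0 < x" using assms by simp
  then obtain z where z: "0 < z" "z < x" "sin x - sin 0 = (x - 0) * cos z"
    using MVT2[of 0 x sin cos] by (auto intro: derivative_eq_intros)
  have "cos (pi / 3) \<le> cos z" using z assms by (intro cos_monotone_0_pi_le) auto
  then have "x * (1 / 2) \<le> x * cos z" using \<open>0 < x\<close> by (intro mult_left_mono) (auto simp: cos_60)
  then show ?thesis using z by simp
qed simp

lemma fs_dist_inner_bound:
  assumes v: "norm v = 1" "norm w = 1" and t: "0 \<le> t" "t \<le> fs_dist (proj_pt v) (proj_pt w)"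
  shows "t\<^sup>2 / 8 \<le> 1 - \<bar>v \<bullet> w\<bar>"
proof -
  define \<phi> where "\<phi> = fs_dist (proj_pt v) (proj_pt w)"
  have c: "\<bar>v \<bullet> w\<bar> \<le> 1" using Cauchy_Schwarz_ineq2[of v w] v by simp
  have \<phi>: "\<phi> = arccos \<bar>v \<bullet> w\<bar>" unfolding \<phi>_def by (rule fs_dist_proj_pt[OF v])
  have "0 \<le> \<phi>" "\<phi> \<le> pi / 2" unfolding \<phi> using c arccos_lbound[of "\<bar>v \<bullet> w\<bar>"] arccos_le_pi2[of "\<bar>v \<bullet> w\<bar>"] by auto
  then have "\<phi> / 2 / 2 \<le> sin (\<phi> / 2)" by (intro sin_ge_half) auto
  then have "(t / 4)\<^sup>2 \<le> (sin (\<phi> / 2))\<^sup>2" using t \<phi>_def by (intro power_mono) auto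
  moreover have "\<bar>v \<bullet> w\<bar> = cos (2 * (\<phi> / 2))" unfolding \<phi> using c by (simp add: cos_arccos)
  then have "\<bar>v \<bullet> w\<bar> = 1 - 2 * (sin (\<phi> / 2))\<^sup>2" unfolding cos_double_sin .
  ultimately show ?thesis by (simp add: power_divide)
qed

text \<open>The circle of radius \<open>1 / sqrt d\<close> around \<open>v\<close> in the plane tangent to the sphere at the unit vector
\<open>v\<close>. On it powers are simple: for \<open>u\<close> and \<open>w\<close> on the circle \<open>(u \<bullet> w)^d = (1 + s / d)^d\<close> with \<open>\<bar>s\<bar> \<le> 1\<close>.\<close>

definition tangent_circle :: "nat \<Rightarrow> real ^ 3 \<Rightarrow> (real ^ 3) set" where
  "tangent_circle d v = {u. u \<bullet> v = 1 \<and> u \<bullet> u = 1 + 1 / real d}"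

text \<open>An orthogonal map taking the first axis to \<open>v\<close> gives coordinates in which all inner products between
points of the circle are explicit.\<close>

lemma tangent_circle_frame:
  fixes v :: "real ^ 3"
  assumes "norm v = 1"
  shows "\<exists>f :: real ^ 3 \<Rightarrow> real ^ 3. linear f \<and> (\<forall>x y. f x \<bullet> f y = x \<bullet> y) \<and>
    (\<forall>d. tangent_circle d v = {f (vector [1, x, y]) |x y. x\<^sup>2 + y\<^sup>2 = 1 / real d})"
proof -
  obtain f :: "real ^ 3 \<Rightarrow> real ^ 3" where f: "orthogonal_transformation f" "f (axis 1 1) = v"
    by (rule orthogonal_transformation_exists_1[OF norm_axis_1[of 1] assms])
  have inner: "f x \<bullet> f y = x \<bullet> y" for x y using f(1) by (simp add: orthogonal_transformation_def)
  have axis: "vector [a, x, y] \<bullet> (axis 1 1 :: real ^ 3) = a" for a x y :: real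
    by (simp add: inner_axis)
  have surj: "surj f" using f(1) by (rule orthogonal_transformation_surj)
  have "tangent_circle d v = {f (vector [1, x, y]) |x y. x\<^sup>2 + y\<^sup>2 = 1 / real d}" for d
  proof (intro equalityI subsetI)
    fix u assume u: "u \<in> tangent_circle d v"
    obtain p where p: "u = f p" using surj by (metis surjD)
    have "p $ 1 = 1" using u f(2) inner[of p "axis 1 1"] by (auto simp: tangent_circle_def p inner_axis)
    moreover have "p \<bullet> p = 1 + 1 / real d" using u inner[of p p] by (auto simp: tangent_circle_def p)
    ultimately have yz: "(p $ 2)\<^sup>2 + (p $ 3)\<^sup>2 = 1 / real d" by (simp add: inner_vec_def sum_3 power2_eq_square)
    have p3: "p = vector [1, p $ 2, p $ 3]"
      using \<open>p $ 1 = 1\<close> by (simp add: vec_eq_iff forall_3)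
    have "u = f (vector [1, p $ 2, p $ 3])" unfolding p by (rule arg_cong[OF p3])
    then show "u \<in> {f (vector [1, x, y]) |x y. x\<^sup>2 + y\<^sup>2 = 1 / real d}" using yz by blast
  next
    fix u assume "u \<in> {f (vector [1, x, y]) |x y. x\<^sup>2 + y\<^sup>2 = 1 / real d}"
    then obtain x y where u: "u = f (vector [1, x, y])" "x\<^sup>2 + y\<^sup>2 = 1 / real d" by auto
    have "u \<bullet> v = 1" unfolding u(1) f(2)[symmetric] inner axis ..
    moreover have "u \<bullet> u = 1 + 1 / real d"
      unfolding u(1) inner u(2)[symmetric] by (simp add: inner_vec_def sum_3 power2_eq_square)
    ultimately show "u \<in> tangent_circle d v" by (simp add: tangent_circle_def)
  qed
  moreover have "linear f" using f(1) by (simp add: orthogonal_transformation_def)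
  ultimately show ?thesis using inner by (intro exI[of _ f] conjI allI)
qed

lemma tangent_circle_net:
  fixes v :: "real ^ 3"
  assumes v: "norm v = 1" and d: "d \<ge> 1" and n: "n \<ge> 1"
  obtains Z where "finite Z" "card Z \<le> n" "Z \<subseteq> tangent_circle d v"
    "\<And>u. u \<in> tangent_circle d v \<Longrightarrow> \<exists>z\<in>Z. norm (u - z) \<le> 2 * pi / (real n * sqrt (real d))"
proof -
  obtain f :: "real ^ 3 \<Rightarrow> real ^ 3" where f: "linear f" "\<And>x y. f x \<bullet> f y = x \<bullet> y"
    and circ: "\<And>d. tangent_circle d v = {f (vector [1, x, y]) |x y. x\<^sup>2 + y\<^sup>2 = 1 / real d}"
    using tangent_circle_frame[OF v] by blast
  define g where "g t = f (vector [1, cos t / sqrt (real d), sin t / sqrt (real d)])" for t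
  define Z where "Z = (\<lambda>k. g (2 * pi * real k / real n)) ` {..<n}"
  have gc: "g t \<in> tangent_circle d v" for t
    unfolding circ g_def using d
    by (intro CollectI exI[of _ "cos t / sqrt (real d)"] exI[of _ "sin t / sqrt (real d)"])
      (auto simp: power_divide add_divide_distrib[symmetric])
  have dist: "norm (g s - g t) \<le> \<bar>s - t\<bar> / sqrt (real d)" for s t
  proof -
    have "(norm (g s - g t))\<^sup>2 = (cos s / sqrt d - cos t / sqrt d)\<^sup>2 + (sin s / sqrt d - sin t / sqrt d)\<^sup>2"
      unfolding g_def linear_diff[OF f(1), symmetric] power2_norm_eq_inner f(2)
      by (simp add: inner_vec_def sum_3 power2_eq_square)
    also have "\<dots> = ((cos s - cos t)\<^sup>2 + (sin s - sin t)\<^sup>2) / d"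
      by (simp add: diff_divide_distrib[symmetric] power_divide add_divide_distrib[symmetric])
    also have "(cos s - cos t)\<^sup>2 + (sin s - sin t)\<^sup>2 = (2 * sin ((s - t) / 2))\<^sup>2"
    proof -
      have "(cos s - cos t)\<^sup>2 + (sin s - sin t)\<^sup>2 = ((sin s)\<^sup>2 + (cos s)\<^sup>2) + ((sin t)\<^sup>2 + (cos t)\<^sup>2) - 2 * cos (s - t)"
        by (simp add: cos_diff power2_diff algebra_simps)
      also have "\<dots> = 2 - 2 * cos (2 * ((s - t) / 2))" by (simp only: sin_cos_squared_add nonzero_mult_div_cancel_left times_divide_eq_right)
      also have "\<dots> = (2 * sin ((s - t) / 2))\<^sup>2" unfolding cos_double_sin by (simp add: power_mult_distrib)
      finally show ?thesis .
    qed
    also have "\<dots> \<le> \<bar>s - t\<bar>\<^sup>2"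
    proof -
      have "\<bar>2 * sin ((s - t) / 2)\<bar> \<le> \<bar>s - t\<bar>" using abs_sin_x_le_abs_x[of "(s - t) / 2"] by simp
      then show ?thesis by (simp add: abs_le_square_iff)
    qed
    finally have "(norm (g s - g t))\<^sup>2 \<le> (\<bar>s - t\<bar> / sqrt d)\<^sup>2"
      by (simp add: power_divide divide_right_mono)
    then show ?thesis by (rule power2_le_imp_le) simp
  qed
  show ?thesis
  proof (rule that[of Z])
    show "finite Z" "card Z \<le> n" by (auto simp: Z_def intro: order_trans[OF card_image_le])
    show "Z \<subseteq> tangent_circle d v" using gc by (auto simp: Z_def)
    fix u assume "u \<in> tangent_circle d v"
    then obtain x y where u: "u = f (vector [1, x, y])" "x\<^sup>2 + y\<^sup>2 = 1 / real d" unfolding circ by auto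
    have "(sqrt d * x)\<^sup>2 + (sqrt d * y)\<^sup>2 = real d * (x\<^sup>2 + y\<^sup>2)"
      by (simp add: power_mult_distrib algebra_simps)
    then have "(sqrt d * x)\<^sup>2 + (sqrt d * y)\<^sup>2 = 1" using d u(2) by simp
    then obtain t where t: "0 \<le> t" "t < 2 * pi" "sqrt d * x = cos t" "sqrt d * y = sin t"
      by (rule sincos_total_2pi)
    have ug: "u = g t" unfolding u g_def t(3,4)[symmetric] using d by simp
    define k where "k = nat \<lfloor>t * n / (2 * pi)\<rfloor>"
    have tn: "0 \<le> t * n / (2 * pi)" using t by simp
    have "t * n / (2 * pi) < n" using t n by (simp add: field_simps)
    then have "k < n" unfolding k_def using tn by linarith
    define h where "h = 2 * pi / real n"
    have h: "h > 0" "2 * pi * k / n = h * k" "t * n / (2 * pi) = t / h" using n by (auto simp: h_def)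
    have "real k \<le> t / h" "t / h < real k + 1"
      unfolding k_def h(3)[symmetric] using tn by linarith+
    then have "h * k \<le> t" "t \<le> h * k + h" using h(1) by (simp_all add: field_simps)
    then have "\<bar>t - 2 * pi * k / n\<bar> \<le> 2 * pi / n" unfolding h(2) h_def[symmetric] by linarith
    then have "norm (u - g (2 * pi * k / n)) \<le> (2 * pi / n) / sqrt d"
      unfolding ug using dist[of t "2 * pi * k / n"] by (meson divide_right_mono order_trans real_sqrt_ge_zero of_nat_0_le_iff)
    then show "\<exists>z\<in>Z. norm (u - z) \<le> 2 * pi / (real n * sqrt (real d))"
      using \<open>k < n\<close> unfolding Z_def by auto
  qed
qed

text \<open>The induction needs the companion bound for \<open>s * ((1 + s)^n - (1 - s)^n)\<close>, since the increment of the sum is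
this product.\<close>

lemma power_sum_lower_bound:
  fixes s :: real
  shows "2 + real n * (real n - 1) * s\<^sup>2 \<le> (1 + s) ^ n + (1 - s) ^ n"
proof -
  have "2 + real n * (real n - 1) * s\<^sup>2 \<le> (1 + s) ^ n + (1 - s) ^ n \<and> 2 * real n * s\<^sup>2 \<le> s * ((1 + s) ^ n - (1 - s) ^ n)"
  proof (induction n)
    case (Suc n)
    let ?A = "(1 + s) ^ n + (1 - s) ^ n" and ?B = "(1 + s) ^ n - (1 - s) ^ n"
    have A: "(1 + s) ^ Suc n + (1 - s) ^ Suc n = ?A + s * ?B" by (simp add: algebra_simps)
    have B: "s * ((1 + s) ^ Suc n - (1 - s) ^ Suc n) = s * ?B + s\<^sup>2 * ?A" by (simp add: power2_eq_square algebra_simps)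
    have "real n * (real n - 1) \<ge> 0" by (cases n) auto
    then have "0 \<le> real n * (real n - 1) * s\<^sup>2" by (rule mult_nonneg_nonneg) simp
    then have "2 \<le> ?A" using Suc by linarith
    then have "s\<^sup>2 * 2 \<le> s\<^sup>2 * ?A" by (intro mult_left_mono) auto
    then show ?case unfolding A B using Suc by (simp add: algebra_simps)
  qed simp
  then show ?thesis ..
qed

text \<open>The four points are the two opposite pairs on a pair of orthogonal axes. The quadratic terms of
\<open>(1 \<plusminus> s)^d\<close> add up to a multiple of \<open>x\<^sup>2 + y\<^sup>2\<close>, which is constant on the circle. Hence the sum is larger,
by almost \<open>1\<close>, than its value \<open>4\<close> at the centre \<open>v\<close>.\<close>

lemma tangent_circle_peaks:
  fixes v :: "real ^ 3"
  assumes v: "norm v = 1" and d: "d \<ge> 1"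
  obtains w :: "nat \<Rightarrow> real ^ 3" where "\<And>k. k < 4 \<Longrightarrow> w k \<in> tangent_circle d v"
    "\<And>u. u \<in> tangent_circle d v \<Longrightarrow> 5 - 1 / real d \<le> (\<Sum>k<4. (w k \<bullet> u) ^ d)"
proof -
  obtain f :: "real ^ 3 \<Rightarrow> real ^ 3" where f: "linear f" "\<And>x y. f x \<bullet> f y = x \<bullet> y"
    and circ: "\<And>d. tangent_circle d v = {f (vector [1, x, y]) |x y. x\<^sup>2 + y\<^sup>2 = 1 / real d}"
    using tangent_circle_frame[OF v] by blast
  define r where "r = 1 / sqrt (real d)"
  have r: "r\<^sup>2 = 1 / real d" using d by (simp add: r_def power_divide)
  define w where "w k = f ([vector [1, r, 0], vector [1, - r, 0], vector [1, 0, r], vector [1, 0, - r]] ! k)" for k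
  show ?thesis
  proof (rule that[of w])
    fix k :: nat assume "k < 4"
    then have "k = 0 \<or> k = 1 \<or> k = 2 \<or> k = 3" by auto
    then show "w k \<in> tangent_circle d v" unfolding circ w_def using r
      by (elim disjE) (force intro: exI[of _ r] exI[of _ "- r"] exI[of _ 0])+
  next
    fix u assume "u \<in> tangent_circle d v"
    then obtain x y where u: "u = f (vector [1, x, y])" "x\<^sup>2 + y\<^sup>2 = 1 / real d" unfolding circ by auto
    have "(\<Sum>k<4. (w k \<bullet> u) ^ d) = ((1 + r * x) ^ d + (1 - r * x) ^ d) + ((1 + r * y) ^ d + (1 - r * y) ^ d)"
      unfolding w_def u(1) f(2) by (simp add: eval_nat_numeral inner_vec_def sum_3)
    also have "\<dots> \<ge> (2 + real d * (real d - 1) * (r * x)\<^sup>2) + (2 + real d * (real d - 1) * (r * y)\<^sup>2)"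
      by (intro add_mono power_sum_lower_bound)
    also have "(2 + real d * (real d - 1) * (r * x)\<^sup>2) + (2 + real d * (real d - 1) * (r * y)\<^sup>2) = 4 + real d * (real d - 1) * (r\<^sup>2 * (x\<^sup>2 + y\<^sup>2))"
      by (simp add: power_mult_distrib algebra_simps)
    also have "\<dots> = 5 - 1 / real d" unfolding r u(2) using d by (simp add: field_simps)
    finally show "5 - 1 / real d \<le> (\<Sum>k<4. (w k \<bullet> u) ^ d)" by simp
  qed
qed

text \<open>Up to \<open>O(1/d)\<close> and cross terms, \<open>w \<bullet> u\<close> is \<open>v \<bullet> v'\<close>. A cross term such as \<open>v \<bullet> h\<close>, with
\<open>h\<close> orthogonal to \<open>v'\<close> and of length at most \<open>1 / sqrt d\<close>, is at most
\<open>sqrt (1 - (v \<bullet> v')\<^sup>2) / sqrt d \<le> sqrt (2 * \<delta> / d) \<le> \<delta> / 4 + 2 / d\<close> for \<open>\<delta> = 1 - \<bar>v \<bullet> v'\<bar>\<close>.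
So the kernel decays as soon as \<open>d * \<delta>\<close> is large.\<close>

lemma inner_near_distant_points:
  fixes v v' w u :: "'a :: real_inner"
  assumes v: "norm v = 1" "norm v' = 1" and d: "d \<ge> 1"
    and w: "w \<bullet> v = 1" "w \<bullet> w \<le> 1 + 1 / real d" and u: "u \<bullet> v' = 1" "u \<bullet> u \<le> 1 + 1 / real d"
  shows "\<bar>w \<bullet> u\<bar> ^ d \<le> exp (5 - real d * (1 - \<bar>v \<bullet> v'\<bar>) / 2)"
proof -
  define c where "c = v \<bullet> v'"
  define \<delta> where "\<delta> = 1 - \<bar>c\<bar>"
  define g h where "g = w - v" and "h = u - v'"
  have vv: "v \<bullet> v = 1" "v' \<bullet> v' = 1" using v by (simp_all add: dot_square_norm)
  have c1: "\<bar>c\<bar> \<le> 1" unfolding c_def using Cauchy_Schwarz_ineq2[of v v'] v by simp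
  have g: "g \<bullet> v = 0" "g \<bullet> g \<le> 1 / real d" and h: "h \<bullet> v' = 0" "h \<bullet> h \<le> 1 / real d"
    using w u vv by (auto simp: g_def h_def inner_diff_left inner_diff_right inner_commute)
  have cross: "\<bar>a \<bullet> e\<bar> \<le> \<delta> / 4 + 2 * (1 / real d)"
    if e: "e \<bullet> a' = 0" "e \<bullet> e \<le> 1 / real d" and a: "a \<bullet> a = 1" "a' \<bullet> a' = 1" "a \<bullet> a' = c" for a a' e :: 'a
  proof -
    have "a \<bullet> e = (a - c *\<^sub>R a') \<bullet> e" using e(1) inner_commute[of e a'] by (simp add: inner_diff_left)
    then have "(a \<bullet> e)\<^sup>2 \<le> ((a - c *\<^sub>R a') \<bullet> (a - c *\<^sub>R a')) * (e \<bullet> e)"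
      using Cauchy_Schwarz_ineq[of "a - c *\<^sub>R a'" e] by simp
    also have "(a - c *\<^sub>R a') \<bullet> (a - c *\<^sub>R a') = 1 - c\<^sup>2"
      using a by (simp add: inner_diff_left inner_diff_right inner_commute power2_eq_square)
    also have "(1 - c\<^sup>2) * (e \<bullet> e) \<le> (2 * \<delta>) * (1 / real d)"
    proof (rule mult_mono)
      have "1 - c\<^sup>2 = \<delta> * (1 + \<bar>c\<bar>)" by (simp add: \<delta>_def algebra_simps power2_eq_square)
      also have "\<dots> \<le> \<delta> * 2" using c1 by (intro mult_left_mono) (auto simp: \<delta>_def)
      finally show "1 - c\<^sup>2 \<le> 2 * \<delta>" by simp
    qed (use e c1 in \<open>auto simp: \<delta>_def\<close>)
    also have "\<dots> = 4 * (\<delta> / 4 * (2 * (1 / real d)))" by simp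
    also have "\<dots> \<le> (\<delta> / 4 + 2 * (1 / real d))\<^sup>2"
      using zero_le_power2[of "\<delta> / 4 - 2 * (1 / real d)"] by (simp add: power2_eq_square algebra_simps)
    finally have "\<bar>a \<bullet> e\<bar> \<le> \<bar>\<delta> / 4 + 2 * (1 / real d)\<bar>" by (simp add: abs_le_square_iff)
    then show ?thesis using c1 by (simp add: \<delta>_def)
  qed
  have "\<bar>v \<bullet> h\<bar> \<le> \<delta> / 4 + 2 * (1 / real d)" using cross[OF h vv] by (simp add: c_def)
  moreover have "\<bar>v' \<bullet> g\<bar> \<le> \<delta> / 4 + 2 * (1 / real d)" using cross[OF g vv(2,1)] by (simp add: c_def inner_commute)
  moreover have "\<bar>g \<bullet> h\<bar> \<le> 1 / real d"
  proof -
    have "(g \<bullet> h)\<^sup>2 \<le> (g \<bullet> g) * (h \<bullet> h)" by (rule Cauchy_Schwarz_ineq)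
    also have "\<dots> \<le> (1 / real d) * (1 / real d)" using g h by (intro mult_mono) auto
    finally have "\<bar>g \<bullet> h\<bar> \<le> \<bar>1 / real d\<bar>" unfolding abs_le_square_iff by (simp add: power2_eq_square)
    then show ?thesis by simp
  qed
  moreover have "\<bar>w \<bullet> u\<bar> \<le> \<bar>c\<bar> + \<bar>v \<bullet> h\<bar> + \<bar>v' \<bullet> g\<bar> + \<bar>g \<bullet> h\<bar>"
  proof -
    have "w \<bullet> u = c + v \<bullet> h + v' \<bullet> g + g \<bullet> h"
      by (simp add: g_def h_def c_def inner_diff_left inner_diff_right inner_commute)
    then show ?thesis by linarith
  qed
  ultimately have "\<bar>w \<bullet> u\<bar> \<le> \<bar>c\<bar> + 2 * (\<delta> / 4 + 2 * (1 / real d)) + 1 / real d" by argo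
  also have "\<dots> = 1 + (5 / real d - \<delta> / 2)" by (simp add: \<delta>_def field_simps)
  also have "\<dots> \<le> exp (5 / real d - \<delta> / 2)" by (rule exp_ge_add_one_self)
  finally have "\<bar>w \<bullet> u\<bar> ^ d \<le> exp (5 / real d - \<delta> / 2) ^ d" by (intro power_mono) auto
  also have "\<dots> = exp (5 - real d * \<delta> / 2)"
    unfolding exp_of_nat_mult[symmetric] using d by (simp add: algebra_simps)
  finally show ?thesis by (simp add: \<delta>_def c_def)
qed

lemma power_one_plus_inverse_le: "d \<ge> 1 \<Longrightarrow> (1 + 1 / real d) ^ d \<le> 3"
proof -
  assume d: "d \<ge> 1"
  have "(1 + 1 / real d) ^ d \<le> exp (1 / real d) ^ d" by (intro power_mono exp_ge_add_one_self) auto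
  also have "\<dots> = exp 1" unfolding exp_of_nat_mult[symmetric] using d by simp
  also have "\<dots> \<le> 3" by (rule exp_le)
  finally show ?thesis .
qed

lemma inner_power_le:
  fixes u w :: "'a :: real_inner"
  assumes d: "d \<ge> 1" and "u \<bullet> u \<le> 1 + 1 / real d" "w \<bullet> w \<le> 1 + 1 / real d"
  shows "\<bar>(u \<bullet> w) ^ d\<bar> \<le> 3"
proof -
  have "(u \<bullet> w)\<^sup>2 \<le> (u \<bullet> u) * (w \<bullet> w)" by (rule Cauchy_Schwarz_ineq)
  also have "\<dots> \<le> (1 + 1 / real d) * (1 + 1 / real d)" using assms by (intro mult_mono) auto
  finally have "\<bar>u \<bullet> w\<bar> \<le> \<bar>1 + 1 / real d\<bar>" unfolding abs_le_square_iff by (simp add: power2_eq_square)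
  then have "\<bar>u \<bullet> w\<bar> ^ d \<le> (1 + 1 / real d) ^ d" by (intro power_mono) auto
  also have "\<dots> \<le> 3" by (rule power_one_plus_inverse_le[OF d])
  finally show ?thesis by (simp add: power_abs)
qed

text \<open>Cauchy-Schwarz bounds the increment by \<open>|x|\<close> times the distance between \<open>u\<close> and \<open>w\<close> in the metric of the
kernel. With \<open>s = (u \<bullet> w) / (1 + 1/d)\<close>, Bernoulli's inequality \<open>1 - s^d \<le> d * (1 - s)\<close> compares that metric with the
Euclidean one.\<close>

lemma kernel_lipschitz:
  fixes e :: "nat \<Rightarrow> 'a :: real_inner \<Rightarrow> real"
  assumes kernel: "\<And>X Y. (\<Sum>i<N. e i X * e i Y) = real N * (X \<bullet> Y) ^ d"
    and d: "d \<ge> 1" and u: "u \<bullet> u = 1 + 1 / real d" "w \<bullet> w = 1 + 1 / real d" "u \<bullet> w \<ge> 0"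
    and x: "\<And>i. i < N \<Longrightarrow> \<bar>x i\<bar> \<le> T" and T: "T \<ge> 0"
  shows "\<bar>(\<Sum>i<N. x i * e i u) - (\<Sum>i<N. x i * e i w)\<bar> \<le> T * real N * sqrt (3 * real d) * norm (u - w)"
proof -
  define \<rho> where "\<rho> = 1 + 1 / real d"
  define s where "s = (u \<bullet> w) / \<rho>"
  have \<rho>: "\<rho> > 1" using d by (simp add: \<rho>_def)
  have s: "s \<ge> 0" "u \<bullet> w = \<rho> * s" using u \<rho> by (auto simp: s_def)
  have nuw: "(norm (u - w))\<^sup>2 = 2 * \<rho> * (1 - s)"
  proof -
    have "(norm (u - w))\<^sup>2 = u \<bullet> u - 2 * (u \<bullet> w) + w \<bullet> w"
      unfolding power2_norm_eq_inner by (simp add: inner_diff_left inner_diff_right inner_commute)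
    then show ?thesis unfolding u s \<rho>_def[symmetric] by (simp add: algebra_simps)
  qed
  have "(\<Sum>i<N. (e i u - e i w)\<^sup>2) = (\<Sum>i<N. e i u * e i u) - 2 * (\<Sum>i<N. e i u * e i w) + (\<Sum>i<N. e i w * e i w)"
    unfolding sum_distrib_left sum_subtractf[symmetric] sum.distrib[symmetric]
    by (intro sum.cong refl) (simp add: power2_eq_square algebra_simps)
  also have "\<dots> = 2 * real N * (\<rho> ^ d * (1 - s ^ d))"
    unfolding kernel u s \<rho>_def[symmetric] by (simp add: power_mult_distrib algebra_simps)
  also have "\<dots> \<le> 2 * real N * (\<rho> ^ d * (real d * (1 - s)))"
  proof -
    have "1 + real d * (s - 1) \<le> (1 + (s - 1)) ^ d" using s by (intro Bernoulli_inequality) auto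
    then show ?thesis using \<rho> by (intro mult_left_mono) (auto simp: algebra_simps)
  qed
  also have "\<dots> = real N * real d * (\<rho> ^ d / \<rho>) * (norm (u - w))\<^sup>2"
    unfolding nuw using \<rho> by simp
  also have "\<dots> \<le> real N * real d * 3 * (norm (u - w))\<^sup>2"
  proof (intro mult_right_mono mult_left_mono)
    have "\<rho> ^ d / \<rho> \<le> \<rho> ^ d" using \<rho> by (simp add: divide_le_eq mult_le_cancel_left1)
    then show "\<rho> ^ d / \<rho> \<le> 3" using power_one_plus_inverse_le[OF d] by (simp add: \<rho>_def)
  qed auto
  finally have inc: "(\<Sum>i<N. (e i u - e i w)\<^sup>2) \<le> real N * real d * 3 * (norm (u - w))\<^sup>2" .
  have "((\<Sum>i<N. x i * e i u) - (\<Sum>i<N. x i * e i w))\<^sup>2 = (\<Sum>i<N. x i * (e i u - e i w))\<^sup>2"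
    unfolding sum_subtractf[symmetric] by (simp add: right_diff_distrib)
  also have "\<dots> \<le> (\<Sum>i<N. (x i)\<^sup>2) * (\<Sum>i<N. (e i u - e i w)\<^sup>2)" by (rule Cauchy_Schwarz_ineq_sum)
  also have "\<dots> \<le> (real N * T\<^sup>2) * (real N * real d * 3 * (norm (u - w))\<^sup>2)"
  proof (intro mult_mono inc)
    have "(\<Sum>i<N. (x i)\<^sup>2) \<le> (\<Sum>i<N. T\<^sup>2)"
      using x T by (intro sum_mono) (auto simp: abs_le_square_iff[symmetric])
    then show "(\<Sum>i<N. (x i)\<^sup>2) \<le> real N * T\<^sup>2" by simp
  qed (auto intro: sum_nonneg)
  also have "\<dots> = (T * real N * sqrt (3 * real d) * norm (u - w))\<^sup>2"
    by (simp add: power_mult_distrib power2_eq_square[of "real N"])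
  finally have "\<bar>(\<Sum>i<N. x i * e i u) - (\<Sum>i<N. x i * e i w)\<bar> \<le> \<bar>T * real N * sqrt (3 * real d) * norm (u - w)\<bar>"
    unfolding abs_le_square_iff .
  then show ?thesis using T by (simp add: abs_mult)
qed

section \<open>The barrier polynomial and the random part\<close>

lemma dim_hpolys_bounds:
  assumes "d \<ge> 1"
  shows "real (dim_hpolys d) \<le> 3 * (real d)\<^sup>2" "real (dim_hpolys d) \<ge> 1"
proof -
  have N: "real (dim_hpolys d) = (real d + 2) * (real d + 1) / 2"
    unfolding dim_hpolys_def by (subst binomial_fact) (auto simp: fact_numeral field_simps)
  have N': "real (dim_hpolys d) = (real d * real d + 3 * real d + 2) / 2"
    unfolding N by (simp add: algebra_simps)
  have "real d \<ge> 1" using assms by simp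
  then have "real d * 1 \<le> real d * real d" by (intro mult_left_mono) auto
  then have sq: "real d \<le> real d * real d" by simp
  show "real (dim_hpolys d) \<le> 3 * (real d)\<^sup>2"
  proof -
    have "(s + 3 * r + 2) / 2 \<le> 3 * s" if "1 \<le> r" "r \<le> s" for r s :: real
    proof -
      have "s + 3 * r + 2 \<le> 6 * s" using that by linarith
      then show ?thesis by simp
    qed
    from this[OF \<open>real d \<ge> 1\<close> sq] show ?thesis unfolding N' power2_eq_square .
  qed
  show "real (dim_hpolys d) \<ge> 1"
  proof -
    have "2 \<le> real d * real d + 3 * real d + 2" using \<open>real d \<ge> 1\<close> sq by linarith
    then show ?thesis unfolding N' by simp
  qed
qed

lemma abs_bump_combination_le:
  fixes A :: "nat \<Rightarrow> real"
  assumes "\<And>k. k < 4 \<Longrightarrow> \<bar>A k\<bar> \<le> C" "\<bar>B\<bar> \<le> C"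
  shows "\<bar>(\<Sum>k<4. A k) - 17 / 4 * B\<bar> \<le> 33 / 4 * C"
proof -
  have "\<bar>\<Sum>k<4. A k\<bar> \<le> (\<Sum>k<(4::nat). C)" using assms by (intro order_trans[OF sum_abs] sum_mono) auto
  then have "\<bar>\<Sum>k<4. A k\<bar> \<le> 4 * C" by simp
  then show ?thesis using assms(2) by linarith
qed

text \<open>The centres \<open>v i\<close> are unit representatives of the given points, \<open>w i k\<close> are the four peaks on the circle around
\<open>v i\<close>, and \<open>e\<close> is any family with the reproducing kernel \<open>N * (X \<bullet> Y)^d\<close>, such as an orthonormal
basis. The bound in \<open>sep\<close> makes \<open>(X \<bullet> Y)^d\<close> at most \<open>1 / (100 * m)\<close> when \<open>X\<close> and \<open>Y\<close> are on
or inside the circles around different centres.\<close>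

locale separated_points =
  fixes d m :: nat and I :: "'i set" and v :: "'i \<Rightarrow> real ^ 3" and w :: "'i \<Rightarrow> nat \<Rightarrow> real ^ 3"
    and N :: nat and e :: "nat \<Rightarrow> real ^ 3 \<Rightarrow> real"
  assumes d: "d \<ge> 2" and I: "finite I" "card I = m" and v: "\<And>i. i \<in> I \<Longrightarrow> norm (v i) = 1"
    and w: "\<And>i k. i \<in> I \<Longrightarrow> k < 4 \<Longrightarrow> w i k \<in> tangent_circle d (v i)"
    and peaks: "\<And>i u. i \<in> I \<Longrightarrow> u \<in> tangent_circle d (v i) \<Longrightarrow> 5 - 1 / real d \<le> (\<Sum>k<4. (w i k \<bullet> u) ^ d)"
    and sep: "\<And>i j. i \<in> I \<Longrightarrow> j \<in> I \<Longrightarrow> i \<noteq> j \<Longrightarrow> 10 + 2 * ln (100 * real m) \<le> real d * (1 - \<bar>v i \<bullet> v j\<bar>)"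
    and kernel: "\<And>X Y. (\<Sum>l<N. e l X * e l Y) = real N * (X \<bullet> Y) ^ d"
    and N: "N \<ge> 1"
begin

text \<open>The weight \<open>17/4\<close> lies halfway between the values \<open>4\<close> at the centre and \<open>5 - 1/d \<ge> 9/2\<close> on the circle of the
sum of the four peaks; the other power is \<open>1\<close> in both places.\<close>

definition bump :: "'i \<Rightarrow> real ^ 3 \<Rightarrow> real" where
  "bump j u = (\<Sum>k<4. (w j k \<bullet> u) ^ d) - 17 / 4 * (v j \<bullet> u) ^ d"

definition barrier :: "real ^ 3 \<Rightarrow> real" where
  "barrier u = (\<Sum>j\<in>I. bump j u)"

text \<open>The coordinates of \<open>sqrt N * barrier\<close> with respect to the family \<open>e\<close>. With this normalization they have
norm \<open>O(m)\<close>, while the values are of the order of \<open>sqrt N\<close>, the typical size of the random polynomial.\<close>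

definition barrier_coeff :: "nat \<Rightarrow> real" where
  "barrier_coeff l = (\<Sum>j\<in>I. (\<Sum>k<4. e l (w j k)) - 17 / 4 * e l (v j)) / sqrt (real N)"

text \<open>Since \<open>barrier\<close> is a combination of kernels, the inner product with it is the same combination of point
evaluations. It is used twice: for the norm of the barrier and for its inner product with the
random part.\<close>

lemma barrier_coeff_pairing:
  "(\<Sum>l<N. barrier_coeff l * x l) =
    (\<Sum>j\<in>I. (\<Sum>k<4. \<Sum>l<N. x l * e l (w j k)) - 17 / 4 * (\<Sum>l<N. x l * e l (v j))) / sqrt (real N)"
proof -
  have "(\<Sum>l<N. barrier_coeff l * x l) = (\<Sum>l<N. \<Sum>j\<in>I. (\<Sum>k<4. x l * e l (w j k)) - 17 / 4 * (x l * e l (v j))) / sqrt (real N)"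
    unfolding barrier_coeff_def sum_divide_distrib
    by (intro sum.cong refl) (simp add: sum_distrib_left sum_distrib_right sum_divide_distrib sum_subtractf algebra_simps diff_divide_distrib)
  also have "(\<Sum>l<N. \<Sum>j\<in>I. (\<Sum>k<4. x l * e l (w j k)) - 17 / 4 * (x l * e l (v j)))
     = (\<Sum>j\<in>I. \<Sum>l<N. (\<Sum>k<4. x l * e l (w j k)) - 17 / 4 * (x l * e l (v j)))"
    by (rule sum.swap)
  also have "\<dots> = (\<Sum>j\<in>I. (\<Sum>k<4. \<Sum>l<N. x l * e l (w j k)) - 17 / 4 * (\<Sum>l<N. x l * e l (v j)))"
    by (intro sum.cong refl) (simp add: sum_subtractf sum.swap[of _ "{..<4}"] sum_distrib_left)
  finally show ?thesis .
qed

lemma barrier_coeff_eval: "(\<Sum>l<N. barrier_coeff l * e l u) = sqrt (real N) * barrier u"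
proof -
  have "(\<Sum>l<N. barrier_coeff l * e l u) = (\<Sum>j\<in>I. real N * bump j u) / sqrt (real N)"
    unfolding barrier_coeff_pairing bump_def
    by (intro arg_cong2[where f="(/)"] sum.cong refl)
      (simp add: kernel inner_commute[of u] sum_distrib_left right_diff_distrib mult.commute[of "e _ u"])
  also have "\<dots> = real N / sqrt (real N) * barrier u"
    unfolding barrier_def by (simp add: sum_distrib_left[symmetric])
  finally show ?thesis by (simp add: real_div_sqrt)
qed

lemma peak_inner: "i \<in> I \<Longrightarrow> k < 4 \<Longrightarrow> w i k \<bullet> v i = 1" "i \<in> I \<Longrightarrow> k < 4 \<Longrightarrow> w i k \<bullet> w i k \<le> 1 + 1 / real d"
  using w by (auto simp: tangent_circle_def)

lemma centre_inner: "i \<in> I \<Longrightarrow> v i \<bullet> v i = 1" "i \<in> I \<Longrightarrow> v i \<bullet> v i \<le> 1 + 1 / real d"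
  using v by (auto simp: dot_square_norm)

lemma bump_bound:
  assumes "j \<in> I" "u \<bullet> u \<le> 1 + 1 / real d"
  shows "\<bar>bump j u\<bar> \<le> 33 / 4 * 3"
  unfolding bump_def using assms peak_inner centre_inner d by (intro abs_bump_combination_le inner_power_le) auto

lemma bump_far:
  assumes ij: "i \<in> I" "j \<in> I" "i \<noteq> j" and u: "u \<bullet> v i = 1" "u \<bullet> u \<le> 1 + 1 / real d"
  shows "\<bar>bump j u\<bar> \<le> 1 / (8 * real m)"
proof -
  have m: "real m \<ge> 1" using I ij by (auto simp: Suc_le_eq card_gt_0_iff)
  have "\<bar>(x \<bullet> u) ^ d\<bar> \<le> 1 / (100 * real m)" if "x \<bullet> v j = 1" "x \<bullet> x \<le> 1 + 1 / real d" for x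
  proof -
    have "\<bar>x \<bullet> u\<bar> ^ d \<le> exp (5 - real d * (1 - \<bar>v j \<bullet> v i\<bar>) / 2)"
      using that u v ij d by (intro inner_near_distant_points) auto
    also have "\<dots> \<le> exp (- ln (100 * real m))"
      using sep[OF ij(2,1)] ij by (simp add: field_simps)
    also have "\<dots> = 1 / (100 * real m)" using m by (simp add: exp_minus inverse_eq_divide)
    finally show ?thesis by (simp add: power_abs)
  qed
  then have "\<bar>bump j u\<bar> \<le> 33 / 4 * (1 / (100 * real m))"
    unfolding bump_def using ij peak_inner centre_inner by (intro abs_bump_combination_le) auto
  also have "\<dots> \<le> 1 / (8 * real m)" using m by (simp add: field_simps)
  finally show ?thesis .
qed

lemma barrier_near_bump:
  assumes i: "i \<in> I" and u: "u \<bullet> v i = 1" "u \<bullet> u \<le> 1 + 1 / real d"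
  shows "\<bar>barrier u - bump i u\<bar> \<le> 1 / 8"
proof -
  have m: "real m \<ge> 1" using I i by (auto simp: Suc_le_eq card_gt_0_iff)
  have "\<bar>barrier u - bump i u\<bar> = \<bar>\<Sum>j\<in>I - {i}. bump j u\<bar>"
    unfolding barrier_def using I i by (simp add: sum.remove)
  also have "\<dots> \<le> (\<Sum>j\<in>I - {i}. 1 / (8 * real m))"
    using i u by (intro order_trans[OF sum_abs] sum_mono bump_far) auto
  also have "\<dots> \<le> real m * (1 / (8 * real m))"
    using I i by (simp add: card_Diff_singleton divide_right_mono)
  also have "\<dots> = 1 / 8" using m by simp
  finally show ?thesis .
qed

lemma barrier_centre: "i \<in> I \<Longrightarrow> barrier (v i) \<le> - 1 / 8"
proof -
  assume i: "i \<in> I"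
  have "bump i (v i) = - 1 / 4" using centre_inner[OF i] peak_inner[OF i] by (simp add: bump_def)
  then show ?thesis using barrier_near_bump[OF i centre_inner[OF i]] by linarith
qed

lemma barrier_circle:
  assumes "i \<in> I" "u \<in> tangent_circle d (v i)"
  shows "barrier u \<ge> 1 / 8"
proof -
  have "1 / real d \<le> 1 / 2" using d by (simp add: field_simps)
  then have "bump i u \<ge> 1 / 4"
    unfolding bump_def using peaks[OF assms] assms by (simp add: tangent_circle_def inner_commute[of "v i"])
  moreover have "\<bar>barrier u - bump i u\<bar> \<le> 1 / 8"
    using assms by (intro barrier_near_bump) (auto simp: tangent_circle_def)
  ultimately show ?thesis by linarith
qed

text \<open>The weights of one bump have absolute values adding up to \<open>4 + 17/4 = 33/4\<close>.\<close>

lemma barrier_coeff_pairing_bound: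
  assumes x: "\<And>i u. i \<in> I \<Longrightarrow> u \<in> insert (v i) (tangent_circle d (v i)) \<Longrightarrow> \<bar>\<Sum>l<N. x l * e l u\<bar> \<le> C * sqrt (real N)"
  shows "\<bar>\<Sum>l<N. barrier_coeff l * x l\<bar> \<le> 33 / 4 * real m * C"
proof -
  have "\<bar>\<Sum>j\<in>I. (\<Sum>k<4. \<Sum>l<N. x l * e l (w j k)) - 17 / 4 * (\<Sum>l<N. x l * e l (v j))\<bar>
      \<le> (\<Sum>j\<in>I. 33 / 4 * (C * sqrt (real N)))"
  proof (rule order_trans[OF sum_abs], rule sum_mono)
    fix j assume "j \<in> I"
    then show "\<bar>(\<Sum>k<4. \<Sum>l<N. x l * e l (w j k)) - 17 / 4 * (\<Sum>l<N. x l * e l (v j))\<bar> \<le> 33 / 4 * (C * sqrt (real N))"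
      using x w by (intro abs_bump_combination_le) auto
  qed
  then have "\<bar>\<Sum>l<N. barrier_coeff l * x l\<bar> \<le> (\<Sum>j\<in>I. 33 / 4 * (C * sqrt (real N))) / sqrt (real N)"
    unfolding barrier_coeff_pairing abs_divide abs_of_nonneg[OF real_sqrt_ge_zero[OF of_nat_0_le_iff]]
    by (rule divide_right_mono) simp
  also have "\<dots> = 33 / 4 * real m * C" using N I by simp
  finally show ?thesis .
qed

lemma barrier_coeff_norm: "(\<Sum>l<N. (barrier_coeff l)\<^sup>2) \<le> 207 * (real m)\<^sup>2"
proof -
  have "\<bar>\<Sum>l<N. barrier_coeff l * barrier_coeff l\<bar> \<le> 33 / 4 * real m * (real m * (33 / 4 * 3))"
  proof (rule barrier_coeff_pairing_bound)
    fix i u assume "i \<in> I" "u \<in> insert (v i) (tangent_circle d (v i))"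
    then have u: "u \<bullet> u \<le> 1 + 1 / real d" using centre_inner[of i] by (auto simp: tangent_circle_def)
    have "\<bar>barrier u\<bar> \<le> (\<Sum>j\<in>I. 33 / 4 * 3)"
      unfolding barrier_def using bump_bound u by (intro order_trans[OF sum_abs] sum_mono) auto
    then have "sqrt (real N) * \<bar>barrier u\<bar> \<le> sqrt (real N) * (real m * (33 / 4 * 3))"
      using I by (intro mult_left_mono) auto
    then show "\<bar>\<Sum>l<N. barrier_coeff l * e l u\<bar> \<le> real m * (33 / 4 * 3) * sqrt (real N)"
      unfolding barrier_coeff_eval by (simp add: abs_mult mult_ac)
  qed
  then have "(\<Sum>l<N. (barrier_coeff l)\<^sup>2) \<le> 33 / 4 * real m * (real m * (33 / 4 * 3))"
    by (simp add: power2_eq_square)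
  also have "\<dots> \<le> 207 * (real m)\<^sup>2" by (simp add: power2_eq_square)
  finally show ?thesis .
qed

text \<open>The bound is imposed on the coordinates of \<open>x\<close> and at the centres and the points of a net with \<open>20 * d\<close> points on
each circle, which costs a union bound over polynomially many Gaussian tails. The bound on the coordinates
makes \<open>kernel_lipschitz\<close> effective at the scale of the net, so that passing to the whole circle
costs only one more \<open>T * sqrt N\<close>.\<close>

lemma noise_bounded_event:
  assumes T: "T \<ge> 0" "2 * (real N + real m * (20 * real d + 1)) * exp (- T\<^sup>2) \<le> 1 / 2"
    and N3: "real N \<le> 3 * (real d)\<^sup>2"
  obtains B where "B \<in> sets (std_gauss N)" "measure (std_gauss N) B \<ge> 1 / 2"
    "\<And>x i u. x \<in> B \<Longrightarrow> i \<in> I \<Longrightarrow> u \<in> insert (v i) (tangent_circle d (v i)) \<Longrightarrow> \<bar>\<Sum>l<N. x l * e l u\<bar> \<le> 3 * T * sqrt (real N)"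
proof -
  interpret prob_space "std_gauss N" by (rule prob_space_std_gauss)
  have d1: "d \<ge> 1" "20 * d \<ge> 1" using d by auto
  have "\<forall>i\<in>I. \<exists>Z. finite Z \<and> card Z \<le> 20 * d \<and> Z \<subseteq> tangent_circle d (v i) \<and>
    (\<forall>u\<in>tangent_circle d (v i). \<exists>z\<in>Z. norm (u - z) \<le> 2 * pi / (real (20 * d) * sqrt (real d)))"
  proof
    fix i assume "i \<in> I"
    obtain Z where "finite Z" "card Z \<le> 20 * d" "Z \<subseteq> tangent_circle d (v i)"
      "\<And>u. u \<in> tangent_circle d (v i) \<Longrightarrow> \<exists>z\<in>Z. norm (u - z) \<le> 2 * pi / (real (20 * d) * sqrt (real d))"
      using tangent_circle_net[OF v[OF \<open>i \<in> I\<close>] d1] by blast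
    then show "\<exists>Z. finite Z \<and> card Z \<le> 20 * d \<and> Z \<subseteq> tangent_circle d (v i) \<and>
      (\<forall>u\<in>tangent_circle d (v i). \<exists>z\<in>Z. norm (u - z) \<le> 2 * pi / (real (20 * d) * sqrt (real d)))" by blast
  qed
  then obtain Z where Z: "\<And>i. i \<in> I \<Longrightarrow> finite (Z i)" "\<And>i. i \<in> I \<Longrightarrow> card (Z i) \<le> 20 * d" "\<And>i. i \<in> I \<Longrightarrow> Z i \<subseteq> tangent_circle d (v i)"
    "\<And>i u. i \<in> I \<Longrightarrow> u \<in> tangent_circle d (v i) \<Longrightarrow> \<exists>z\<in>Z i. norm (u - z) \<le> 2 * pi / (real (20 * d) * sqrt (real d))"
    by metis
  define Y where "Y = (\<Union>i\<in>I. insert (v i) (Z i))"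
  have finY: "finite Y" using Z I by (auto simp: Y_def)
  have cardY: "real (card Y) \<le> real m * (20 * real d + 1)"
  proof -
    have "card Y \<le> (\<Sum>i\<in>I. card (insert (v i) (Z i)))" unfolding Y_def by (rule card_UN_le[OF I(1)])
    also have "\<dots> \<le> (\<Sum>i\<in>I. 20 * d + 1)" using Z(1,2) by (intro sum_mono) (auto simp: card_insert_if le_SucI)
    finally have "card Y \<le> m * (20 * d + 1)" using I by simp
    then have "real (card Y) \<le> real (m * (20 * d + 1))" by (rule of_nat_mono)
    then show ?thesis unfolding of_nat_mult of_nat_add by simp
  qed
  have Yn: "z \<bullet> z \<le> 1 + 1 / real d" if "z \<in> Y" for z
    using that Z(3) centre_inner by (force simp: Y_def tangent_circle_def)
  define A1 where "A1 l = {x \<in> space (std_gauss N). \<bar>\<Sum>k<N. (if k = l then 1 else 0) * x k\<bar> > T * 1}" for l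
  define A2 where "A2 z = {x \<in> space (std_gauss N). \<bar>\<Sum>k<N. e k z * x k\<bar> > T * (2 * sqrt (real N))}" for z
  have [measurable]: "A1 l \<in> events" "A2 z \<in> events" for l z unfolding A1_def A2_def by measurable
  have A1: "prob (A1 l) \<le> 2 * exp (- T\<^sup>2)" if "l < N" for l
    unfolding A1_def using T(1) that by (intro std_gauss_tail) (auto simp: if_distrib[of "\<lambda>x. x\<^sup>2"] sum.delta cong: if_cong)
  have A2: "prob (A2 z) \<le> 2 * exp (- T\<^sup>2)" if "z \<in> Y" for z
    unfolding A2_def
  proof (intro std_gauss_tail T(1))
    have "(\<Sum>k<N. (e k z)\<^sup>2) = real N * (z \<bullet> z) ^ d" using kernel[of z z] by (simp add: power2_eq_square)
    also have "\<dots> \<le> real N * 3" using inner_power_le[OF d1(1) Yn[OF that] Yn[OF that]] by (intro mult_left_mono) auto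
    also have "\<dots> \<le> (2 * sqrt (real N))\<^sup>2" by (simp add: power_mult_distrib)
    finally show "(\<Sum>k<N. (e k z)\<^sup>2) \<le> (2 * sqrt (real N))\<^sup>2" .
  qed (use N in auto)
  define Bad where "Bad = (\<Union>l<N. A1 l) \<union> (\<Union>z\<in>Y. A2 z)"
  have Bad_ev: "Bad \<in> events" unfolding Bad_def using finY by (intro sets.Un sets.finite_UN) auto
  have "prob Bad \<le> prob (\<Union>l<N. A1 l) + prob (\<Union>z\<in>Y. A2 z)"
    unfolding Bad_def using finY by (intro measure_Un_le sets.finite_UN) auto
  also have "\<dots> \<le> (\<Sum>l<N. prob (A1 l)) + (\<Sum>z\<in>Y. prob (A2 z))"
    using finY by (intro add_mono measure_UNION_le) auto
  also have "\<dots> \<le> (\<Sum>l<N. 2 * exp (- T\<^sup>2)) + (\<Sum>z\<in>Y. 2 * exp (- T\<^sup>2))"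
    using A1 A2 by (intro add_mono sum_mono) auto
  also have "\<dots> = 2 * (real N + real (card Y)) * exp (- T\<^sup>2)" by (simp add: algebra_simps)
  also have "\<dots> \<le> 2 * (real N + real m * (20 * real d + 1)) * exp (- T\<^sup>2)"
    using cardY by (intro mult_right_mono mult_left_mono add_left_mono) auto
  also note T(2)
  finally have "prob Bad \<le> 1 / 2" .
  show ?thesis
  proof (rule that[of "space (std_gauss N) - Bad"])
    show "space (std_gauss N) - Bad \<in> events" using Bad_ev by auto
    show "prob (space (std_gauss N) - Bad) \<ge> 1 / 2"
      using prob_compl[OF Bad_ev] \<open>prob Bad \<le> 1 / 2\<close> by simp
    fix x i u
    assume x: "x \<in> space (std_gauss N) - Bad" and i: "i \<in> I" and u: "u \<in> insert (v i) (tangent_circle d (v i))"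
    have xl: "\<bar>x l\<bar> \<le> T" if "l < N" for l
    proof -
      have "(\<Sum>k<N. (if k = l then 1 else 0) * x k) = (\<Sum>k<N. if k = l then x k else 0)"
        by (intro sum.cong) auto
      also have "\<dots> = x l" using that by (simp add: sum.delta)
      finally have eq: "(\<Sum>k<N. (if k = l then 1 else 0) * x k) = x l" .
      have "x \<in> space (std_gauss N)" "x \<notin> A1 l" using x that by (auto simp: Bad_def)
      then show ?thesis unfolding A1_def mem_Collect_eq eq by simp
    qed
    have xz: "\<bar>\<Sum>l<N. x l * e l z\<bar> \<le> 2 * T * sqrt (real N)" if "z \<in> Y" for z
      using x that by (auto simp: Bad_def A2_def mult_ac not_less)
    show "\<bar>\<Sum>l<N. x l * e l u\<bar> \<le> 3 * T * sqrt (real N)"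
    proof (cases "u = v i")
      case True
      then have "\<bar>\<Sum>l<N. x l * e l u\<bar> \<le> 2 * T * sqrt (real N)" using xz i by (auto simp: Y_def)
      moreover have "0 \<le> T * sqrt (real N)" using T by simp
      ultimately show ?thesis by simp
    next
      case False
      then have uc: "u \<in> tangent_circle d (v i)" using u by simp
      then obtain z where z: "z \<in> Z i" "norm (u - z) \<le> 2 * pi / (real (20 * d) * sqrt (real d))"
        using Z(4)[OF i] by blast
      have zc: "z \<in> tangent_circle d (v i)" using z Z(3)[OF i] by auto
      \<comment> \<open>The net is fine enough: its mesh times the Lipschitz constant is at most \<open>6 * pi * d / (20 * d) \<le> 1\<close> in units of \<open>T * sqrt N\<close>, because \<open>N \<le> 3 * d^2\<close>.\<close>
      have pi: "2 * pi \<le> 20 / 3" using pi_less_4 pi_approx by simp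
      have "2 * pi / (real (20 * d) * sqrt (real d)) \<le> (20 / 3) / (20 * 1)"
        using d pi by (intro frac_le mult_mono) auto
      then have "norm (u - z) \<le> 1" using z by simp
      then have "(norm (u - z))\<^sup>2 \<le> 1" by (simp add: power_le_one)
      then have uz: "u \<bullet> z \<ge> 0"
      proof -
        have "(norm (u - z))\<^sup>2 = u \<bullet> u - 2 * (u \<bullet> z) + z \<bullet> z"
          unfolding power2_norm_eq_inner by (simp add: inner_diff_left inner_diff_right inner_commute)
        moreover have "u \<bullet> u \<ge> 1" "z \<bullet> z \<ge> 1" using uc zc by (auto simp: tangent_circle_def)
        ultimately show ?thesis using \<open>(norm (u - z))\<^sup>2 \<le> 1\<close> by linarith
      qed
      have "\<bar>(\<Sum>l<N. x l * e l u) - (\<Sum>l<N. x l * e l z)\<bar> \<le> T * real N * sqrt (3 * real d) * norm (u - z)"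
        using uc zc by (intro kernel_lipschitz kernel d1 uz xl T) (auto simp: tangent_circle_def)
      also have "\<dots> \<le> T * real N * sqrt (3 * real d) * (2 * pi / (real (20 * d) * sqrt (real d)))"
        using z T by (intro mult_left_mono) auto
      also have "\<dots> = T * sqrt (real N) * (sqrt (real N) * sqrt 3 * (2 * pi) / (20 * real d))"
      proof -
        have "real N = sqrt (real N) * sqrt (real N)" by simp
        then show ?thesis using d by (simp add: real_sqrt_mult mult_ac)
      qed
      also have "\<dots> \<le> T * sqrt (real N) * 1"
      proof (intro mult_left_mono)
        have "sqrt (real N) * sqrt 3 = sqrt (3 * real N)" by (simp add: real_sqrt_mult)
        also have "\<dots> \<le> sqrt ((3 * real d)\<^sup>2)" using N3 by (intro real_sqrt_le_mono) (simp add: power_mult_distrib)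
        also have "\<dots> = 3 * real d" unfolding real_sqrt_abs by simp
        finally have "sqrt (real N) * sqrt 3 \<le> 3 * real d" .
        then have "sqrt (real N) * sqrt 3 * (2 * pi) \<le> 3 * real d * (20 / 3)" using pi by (rule mult_mono) auto
        then show "sqrt (real N) * sqrt 3 * (2 * pi) / (20 * real d) \<le> 1" using d by (simp add: field_simps)
      qed (use T in auto)
      finally have "\<bar>(\<Sum>l<N. x l * e l u) - (\<Sum>l<N. x l * e l z)\<bar> \<le> T * sqrt (real N)" by simp
      moreover have "\<bar>\<Sum>l<N. x l * e l z\<bar> \<le> 2 * T * sqrt (real N)" using xz z i by (auto simp: Y_def)
      ultimately show ?thesis by linarith
    qed
  qed
qed

text \<open>In units of \<open>T * sqrt N\<close> the barrier contributes at least \<open>32/8 = 4\<close>, with the desired sign, and the random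
part at most \<open>3\<close> in absolute value.\<close>

lemma perturbed_barrier_signs:
  assumes T: "T > 0" and i: "i \<in> I"
    and x: "\<And>u. u \<in> insert (v i) (tangent_circle d (v i)) \<Longrightarrow> \<bar>\<Sum>l<N. x l * e l u\<bar> \<le> 3 * T * sqrt (real N)"
  shows "(\<Sum>l<N. (x l + 32 * T * barrier_coeff l) * e l (v i)) < 0"
    and "u \<in> tangent_circle d (v i) \<Longrightarrow> (\<Sum>l<N. (x l + 32 * T * barrier_coeff l) * e l u) > 0"
proof -
  have split: "(\<Sum>l<N. (x l + 32 * T * barrier_coeff l) * e l u) = (\<Sum>l<N. x l * e l u) + 32 * T * sqrt (real N) * barrier u" for u
  proof -
    have "(\<Sum>l<N. (x l + 32 * T * barrier_coeff l) * e l u) = (\<Sum>l<N. x l * e l u) + 32 * T * (\<Sum>l<N. barrier_coeff l * e l u)"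
      unfolding sum_distrib_left sum.distrib[symmetric] by (intro sum.cong refl) (simp add: algebra_simps)
    then show ?thesis unfolding barrier_coeff_eval by simp
  qed
  have pos: "T * sqrt (real N) > 0" using T N by simp
  have "T * sqrt (real N) * (32 * barrier (v i)) \<le> T * sqrt (real N) * (- 4)"
    using barrier_centre[OF i] pos by (intro mult_left_mono) auto
  then show "(\<Sum>l<N. (x l + 32 * T * barrier_coeff l) * e l (v i)) < 0"
    unfolding split using x[of "v i"] pos by (simp add: abs_le_iff algebra_simps)
  assume u: "u \<in> tangent_circle d (v i)"
  have "T * sqrt (real N) * 4 \<le> T * sqrt (real N) * (32 * barrier u)"
    using barrier_circle[OF i u] pos by (intro mult_left_mono) auto
  then show "(\<Sum>l<N. (x l + 32 * T * barrier_coeff l) * e l u) > 0"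
    unfolding split using x[of u] u pos by (simp add: abs_le_iff algebra_simps)
qed

end

text \<open>The threshold \<open>T = 2 * sqrt (ln d)\<close> makes each Gaussian tail \<open>d^(-4)\<close>, less than the reciprocal of the number of
constraints in \<open>noise_bounded_event\<close>. The shift by \<open>32 * T\<close> times the barrier then costs a factor
\<open>exp (- O(m^2 * T^2))\<close>, a power of \<open>d\<close> with exponent \<open>O(m^2)\<close>. One more power of \<open>d\<close> absorbs
the probability \<open>1/2\<close> of the event.\<close>

lemma kostlan_separation_probability:
  fixes p :: "nat \<Rightarrow> rp2"
  assumes m: "m \<ge> 1" and large: "real d \<ge> 96 * real m"
    and far: "\<And>i j. i \<in> {1..m} \<Longrightarrow> j \<in> {1..m} \<Longrightarrow> i \<noteq> j \<Longrightarrow> t \<le> fs_dist (p i) (p j)"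
    and t: "t \<ge> 0" "real d * t\<^sup>2 \<ge> 80 + 16 * ln (100 * real m)"
  shows "\<P>(P in kostlan d. in_different_components {1..m} p (- real_curve d P)) \<ge> real d powr (- (856000 * (real m)\<^sup>2 + 1))"
proof -
  have m1: "real m \<ge> 1" using m by simp
  have d2: "d \<ge> 2" "d \<ge> 1" and d1: "real d \<ge> 2" using large m1 by linarith+
  let ?N = "dim_hpolys d"
  obtain b where b: "orthonormal_basis d b"
    and kost: "kostlan d = distr (std_gauss ?N) (\<Pi>\<^sub>M a\<in>monoms d. borel)
        (\<lambda>x. \<lambda>a\<in>monoms d. \<Sum>i<?N. x i * b i a)"
    by (rule kostlan_eq_distr)
  define e where "e l u = hpoly_eval d (b l) u" for l and u :: "real ^ 3"
  define F where "F x = (\<lambda>a\<in>monoms d. \<Sum>i<?N. x i * b i a)" for x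
  have evalF: "hpoly_eval d (F x) u = (\<Sum>l<?N. x l * e l u)" for x u
    unfolding F_def e_def by (rule hpoly_eval_combination)
  have "\<forall>i. \<exists>v. norm v = 1 \<and> proj_pt v = p i" using proj_pt_unit_representative by metis
  then obtain v where vu: "\<And>i. norm (v i) = 1" "\<And>i. proj_pt (v i) = p i" by metis
  have "\<forall>i. \<exists>w :: nat \<Rightarrow> real ^ 3. (\<forall>k<4. w k \<in> tangent_circle d (v i)) \<and>
     (\<forall>u\<in>tangent_circle d (v i). 5 - 1 / real d \<le> (\<Sum>k<4. (w k \<bullet> u) ^ d))"
  proof
    fix i
    obtain w :: "nat \<Rightarrow> real ^ 3" where "\<And>k. k < 4 \<Longrightarrow> w k \<in> tangent_circle d (v i)"
      "\<And>u. u \<in> tangent_circle d (v i) \<Longrightarrow> 5 - 1 / real d \<le> (\<Sum>k<4. (w k \<bullet> u) ^ d)"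
      using tangent_circle_peaks[OF vu(1) d2(2)] by blast
    then show "\<exists>w :: nat \<Rightarrow> real ^ 3. (\<forall>k<4. w k \<in> tangent_circle d (v i)) \<and>
     (\<forall>u\<in>tangent_circle d (v i). 5 - 1 / real d \<le> (\<Sum>k<4. (w k \<bullet> u) ^ d))" by blast
  qed
  then obtain w :: "nat \<Rightarrow> nat \<Rightarrow> real ^ 3" where w: "\<And>i k. k < 4 \<Longrightarrow> w i k \<in> tangent_circle d (v i)"
      "\<And>i u. u \<in> tangent_circle d (v i) \<Longrightarrow> 5 - 1 / real d \<le> (\<Sum>k<4. (w i k \<bullet> u) ^ d)"
    by metis
  \<comment> \<open>A Fubini-Study distance of at least \<open>t\<close> keeps \<open>\<bar>v i \<bullet> v j\<bar>\<close> at most \<open>1 - t^2 / 8\<close>.\<close>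
  have sep: "10 + 2 * ln (100 * real m) \<le> real d * (1 - \<bar>v i \<bullet> v j\<bar>)"
    if "i \<in> {1..m}" "j \<in> {1..m}" "i \<noteq> j" for i j
  proof -
    have "t\<^sup>2 / 8 \<le> 1 - \<bar>v i \<bullet> v j\<bar>"
      using far[OF that] t vu by (intro fs_dist_inner_bound) auto
    then have "real d * (t\<^sup>2 / 8) \<le> real d * (1 - \<bar>v i \<bullet> v j\<bar>)" by (intro mult_left_mono) auto
    then show ?thesis using t(2) by simp
  qed
  interpret separated_points d m "{1..m}" v w ?N e
  proof
    show "(\<Sum>l<?N. e l X * e l Y) = real ?N * (X \<bullet> Y) ^ d" for X Y
      unfolding e_def by (rule reproducing_kernel[OF b])
    show "?N \<ge> 1" using dim_hpolys_bounds(2)[OF d2(2)] by simp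
  qed (use d2 vu w sep in auto)
  interpret prob_space "std_gauss ?N" by (rule prob_space_std_gauss)

  define T where "T = 2 * sqrt (ln (real d))"
  have ln: "ln (real d) > 0" using d1 by simp
  have T: "T > 0" "T\<^sup>2 = 4 * ln (real d)" using ln by (auto simp: T_def power_mult_distrib)
  have "2 * (real ?N + real m * (20 * real d + 1)) * exp (- T\<^sup>2) \<le> 1 / 2"
  proof -
    have "exp (- T\<^sup>2) = inverse (real d ^ 4)"
      unfolding T(2) exp_minus using d1 exp_of_nat_mult[of 4 "ln (real d)"] by simp
    moreover have "2 * (real ?N + real m * (20 * real d + 1)) \<le> real d ^ 4 / 2"
    proof -
      have "real m * (20 * real d + 1) \<le> real m * (21 * (real d * real d))"
      proof (intro mult_left_mono)
        have "real d * 1 \<le> real d * real d" using d1 by (intro mult_left_mono) auto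
        then show "20 * real d + 1 \<le> 21 * (real d * real d)" using d1 by linarith
      qed auto
      moreover have "real ?N \<le> real m * (3 * (real d * real d))"
      proof -
        have "1 * (3 * (real d * real d)) \<le> real m * (3 * (real d * real d))"
          using m1 by (intro mult_right_mono) auto
        then show ?thesis using dim_hpolys_bounds(1)[OF d2(2)] by (simp add: power2_eq_square)
      qed
      ultimately have "2 * (real ?N + real m * (20 * real d + 1)) \<le> 48 * real m * (real d * real d)" by simp
      also have "\<dots> \<le> real d / 2 * (real d * real d)" using large by (intro mult_right_mono) auto
      also have "\<dots> \<le> real d ^ 4 / 2"
        using d1 power_increasing[of 3 4 "real d"] by (simp add: power3_eq_cube)
      finally show ?thesis .
    qed
    ultimately have "2 * (real ?N + real m * (20 * real d + 1)) * exp (- T\<^sup>2) \<le> real d ^ 4 / 2 * inverse (real d ^ 4)"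
      by (intro mult_mono) auto
    also have "\<dots> = 1 / 2" using d1 by simp
    finally show ?thesis .
  qed
  from noise_bounded_event[OF less_imp_le[OF T(1)] this dim_hpolys_bounds(1)[OF d2(2)]]
  obtain B where B: "B \<in> events" "prob B \<ge> 1 / 2"
    "\<And>x i u. x \<in> B \<Longrightarrow> i \<in> {1..m} \<Longrightarrow> u \<in> insert (v i) (tangent_circle d (v i)) \<Longrightarrow> \<bar>\<Sum>l<?N. x l * e l u\<bar> \<le> 3 * T * sqrt (real ?N)"
    by blast

  let ?Ev = "\<lambda>P. in_different_components {1..m} p (- real_curve d P)"
  define q where "q l = 32 * T * barrier_coeff l" for l
  define A where "A = {x \<in> space (std_gauss ?N). ?Ev (F x)}"
  have F_meas: "F \<in> std_gauss ?N \<rightarrow>\<^sub>M (\<Pi>\<^sub>M a\<in>monoms d. borel)"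
    unfolding F_def by measurable
  have Ev: "{P \<in> space (\<Pi>\<^sub>M a\<in>monoms d. borel). ?Ev P} \<in> sets (\<Pi>\<^sub>M a\<in>monoms d. borel :: real measure)"
    by (rule measurable_in_different_components[OF d2(2)]) simp
  have A_eq: "A = F -` {P \<in> space (\<Pi>\<^sub>M a\<in>monoms d. borel). ?Ev P} \<inter> space (std_gauss ?N)"
    using measurable_space[OF F_meas] by (auto simp: A_def)
  have A_ev: "A \<in> events" unfolding A_eq by (rule measurable_sets[OF F_meas Ev])
  have prob_eq: "\<P>(P in kostlan d. ?Ev P) = prob A"
    unfolding kost F_def[symmetric] A_eq space_distr by (rule measure_distr[OF F_meas Ev])

  have "(\<lambda>l\<in>{..<?N}. x l + q l) \<in> A" if x: "x \<in> B" for x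
  proof -
    let ?P = "F (\<lambda>l\<in>{..<?N}. x l + q l)"
    have eval: "hpoly_eval d ?P u = (\<Sum>l<?N. (x l + 32 * T * barrier_coeff l) * e l u)" for u
      unfolding evalF q_def by (intro sum.cong) auto
    have neg: "hpoly_eval d ?P (v i) < 0" if "i \<in> {1..m}" for i
      unfolding eval using B(3)[OF x that] by (intro perturbed_barrier_signs(1) T that)
    have pos: "hpoly_eval d ?P u > 0" if "i \<in> {1..m}" "u \<in> tangent_circle d (v i)" for i u
      unfolding eval using B(3)[OF x that(1)] that by (intro perturbed_barrier_signs(2) T that(1))
    have v0: "v i \<noteq> 0" for i using vu(1)[of i] by auto
    have "\<not> connected_component (- real_curve d ?P) (p i) (p j)" if ij: "i \<in> {1..m}" "j \<in> {1..m}" "i \<noteq> j" for i j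
    proof -
      \<comment> \<open>The other points lie far outside the cone spanned by the circle around \<open>v i\<close>.\<close>
      have outside: "(real d + 1) * (v j \<bullet> v i)\<^sup>2 \<le> real d * (v j \<bullet> v j)"
      proof -
        define c where "c = \<bar>v j \<bullet> v i\<bar>"
        have c: "0 \<le> c" "c \<le> 1" unfolding c_def using Cauchy_Schwarz_ineq2[of "v j" "v i"] vu by auto
        have "ln (100 * real m) \<ge> 0" using m1 by simp
        then have "1 \<le> real d * (1 - c)" using sep[OF ij] by (simp add: c_def inner_commute)
        then have "(real d + 1) * c \<le> real d" using c by (simp add: algebra_simps)
        moreover have "c\<^sup>2 \<le> c" using c by (simp add: power2_eq_square mult_left_le)
        then have "(real d + 1) * c\<^sup>2 \<le> (real d + 1) * c" by (intro mult_left_mono) auto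
        moreover have "c\<^sup>2 = (v j \<bullet> v i)\<^sup>2" by (simp add: c_def)
        ultimately have "(real d + 1) * (v j \<bullet> v i)\<^sup>2 \<le> real d" by (metis order_trans)
        then show ?thesis using vu(1)[of j] by (simp add: dot_square_norm)
      qed
      have circ: "hpoly_eval d ?P u > 0" if "u \<bullet> v i = 1" "u \<bullet> u = 1 + 1 / real d" for u
        using pos[OF ij(1)] that by (simp add: tangent_circle_def)
      have "\<not> connected_component (nonzero_cone d ?P) (v i) (v j)"
        by (rule sign_change_separates[OF d2(2) neg[OF ij(1)] vu(1) circ outside])
      moreover have "\<not> connected_component (nonzero_cone d ?P) (v i) (- v j)"
        by (rule sign_change_separates[OF d2(2) neg[OF ij(1)] vu(1) circ]) (use outside in auto)
      ultimately show ?thesis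
        unfolding vu(2)[symmetric] connected_component_complement_iff[OF d2(2) v0 v0] by blast
    qed
    moreover have "p i \<in> - real_curve d ?P" if "i \<in> {1..m}" for i
      unfolding vu(2)[symmetric] proj_pt_in_complement[OF v0] nonzero_cone_def using neg[OF that] by simp
    ultimately have "?Ev ?P" unfolding in_different_components_iff by blast
    then show ?thesis by (simp add: A_def space_std_gauss)
  qed
  moreover have "(\<Sum>l<?N. q l * x l) \<le> 800 * (real m * T\<^sup>2)" if x: "x \<in> B" for x
  proof -
    have "\<bar>\<Sum>l<?N. barrier_coeff l * x l\<bar> \<le> 33 / 4 * real m * (3 * T)"
      using B(3)[OF x] by (intro barrier_coeff_pairing_bound) auto
    then have "32 * T * (\<Sum>l<?N. barrier_coeff l * x l) \<le> 32 * T * (33 / 4 * real m * (3 * T))"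
      using T by (intro mult_left_mono) auto
    also have "\<dots> \<le> 800 * (real m * T\<^sup>2)" using T(1) by (simp add: power2_eq_square)
    finally show ?thesis by (simp add: q_def sum_distrib_left mult_ac)
  qed
  ultimately have "exp (- (\<Sum>l<?N. (q l)\<^sup>2) - 2 * (800 * (real m * T\<^sup>2))) * prob B \<le> prob A"
    by (rule std_gauss_translation[OF A_ev B(1)])
  moreover have "exp (- (856000 * (real m)\<^sup>2 * ln (real d))) * (1 / 2) \<le> exp (- (\<Sum>l<?N. (q l)\<^sup>2) - 2 * (800 * (real m * T\<^sup>2))) * prob B"
  proof (intro mult_mono B(2))
    have "(\<Sum>l<?N. (q l)\<^sup>2) = 1024 * T\<^sup>2 * (\<Sum>l<?N. (barrier_coeff l)\<^sup>2)"
      by (simp add: q_def power_mult_distrib sum_distrib_left)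
    also have "\<dots> \<le> 1024 * T\<^sup>2 * (207 * (real m)\<^sup>2)" by (intro mult_left_mono barrier_coeff_norm) auto
    finally have 1: "(\<Sum>l<?N. (q l)\<^sup>2) \<le> 847872 * ((real m)\<^sup>2 * ln (real d))" by (simp add: T(2) mult.commute)
    have "real m * ln (real d) \<le> (real m)\<^sup>2 * ln (real d)"
      using m1 ln by (intro mult_right_mono) (auto simp: power2_eq_square)
    then have 2: "2 * (800 * (real m * T\<^sup>2)) \<le> 6400 * ((real m)\<^sup>2 * ln (real d))" by (simp add: T(2) mult.commute)
    have 3: "0 \<le> (real m)\<^sup>2 * ln (real d)" using ln by simp
    have "- (856000 * ((real m)\<^sup>2 * ln (real d))) \<le> - (\<Sum>l<?N. (q l)\<^sup>2) - 2 * (800 * (real m * T\<^sup>2))"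
      using 1 2 3 by linarith
    then show "exp (- (856000 * (real m)\<^sup>2 * ln (real d))) \<le> exp (- (\<Sum>l<?N. (q l)\<^sup>2) - 2 * (800 * (real m * T\<^sup>2)))"
      by (simp add: mult.assoc)
  qed auto
  moreover have "real d powr (- (856000 * (real m)\<^sup>2 + 1)) \<le> exp (- (856000 * (real m)\<^sup>2 * ln (real d))) * (1 / 2)"
  proof -
    have "real d powr (- (856000 * (real m)\<^sup>2 + 1)) = real d powr (- (856000 * (real m)\<^sup>2)) * real d powr (- 1)"
      unfolding powr_add[symmetric] by simp
    also have "\<dots> \<le> real d powr (- (856000 * (real m)\<^sup>2)) * (1 / 2)"
      using d1 by (intro mult_left_mono) (auto simp: powr_minus field_simps)
    finally show ?thesis using d1 by (simp add: powr_def)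
  qed
  ultimately show ?thesis unfolding prob_eq by linarith
qed

theorem theorem5p15:
  fixes m :: nat
  assumes "m \<ge> 1"
  shows "\<exists>\<beta>>0. \<forall>\<epsilon>>0. \<exists>d0. \<forall>d\<ge>d0. \<forall>p :: nat \<Rightarrow> rp2.
    (\<forall>i\<in>{1..m}. \<forall>j\<in>{1..m}. i \<noteq> j \<longrightarrow> fs_dist (p i) (p j) \<ge> 2 * real d powr (- 1 / 2 + \<epsilon>)) \<longrightarrow>
    \<P>(P in kostlan d. in_different_components {1..m} p (- real_curve d P)) \<ge> real d powr (- \<beta>)"
proof (intro exI[of _ "856000 * (real m)\<^sup>2 + 1"] conjI allI impI)
  show "0 < 856000 * (real m)\<^sup>2 + 1" by (simp add: add_nonneg_pos)
  fix \<epsilon> :: real assume "\<epsilon> > 0"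
  define L where "L = 20 + 4 * ln (100 * real m)"
  have "L > 0" using assms by (simp add: L_def add_pos_nonneg)
  \<comment> \<open>For \<open>t = 2 * d powr (-1/2 + \<epsilon>)\<close> one has \<open>d * t^2 = 4 * d powr (2 * \<epsilon>)\<close>, which must reach \<open>4 * L\<close>.\<close>
  obtain d0 :: nat where d0': "max (L powr (1 / (2 * \<epsilon>))) (96 * real m) \<le> real d0"
    using real_arch_simple by blast
  have d0: "L \<le> real d powr (2 * \<epsilon>) \<and> 96 * real m \<le> real d" if "d \<ge> d0" for d
  proof -
    have d: "L powr (1 / (2 * \<epsilon>)) \<le> real d" "96 * real m \<le> real d" using d0' that by auto
    have "L = (L powr (1 / (2 * \<epsilon>))) powr (2 * \<epsilon>)" using \<open>L > 0\<close> \<open>\<epsilon> > 0\<close> by (simp add: powr_powr)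
    also have "\<dots> \<le> real d powr (2 * \<epsilon>)" using d \<open>\<epsilon> > 0\<close> by (intro powr_mono2) auto
    finally show ?thesis using d by simp
  qed
  show "\<exists>d0. \<forall>d\<ge>d0. \<forall>p :: nat \<Rightarrow> rp2.
    (\<forall>i\<in>{1..m}. \<forall>j\<in>{1..m}. i \<noteq> j \<longrightarrow> fs_dist (p i) (p j) \<ge> 2 * real d powr (- 1 / 2 + \<epsilon>)) \<longrightarrow>
    \<P>(P in kostlan d. in_different_components {1..m} p (- real_curve d P)) \<ge> real d powr (- (856000 * (real m)\<^sup>2 + 1))"
  proof (intro exI[of _ d0] allI impI)
    fix d :: nat and p :: "nat \<Rightarrow> rp2"
    assume d: "d \<ge> d0"
      and far: "\<forall>i\<in>{1..m}. \<forall>j\<in>{1..m}. i \<noteq> j \<longrightarrow> fs_dist (p i) (p j) \<ge> 2 * real d powr (- 1 / 2 + \<epsilon>)"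
    have "real d > 0" using d0[OF d] assms by linarith
    have "real d * (2 * real d powr (- 1 / 2 + \<epsilon>))\<^sup>2 = 4 * (real d powr 1 * real d powr (2 * (- 1 / 2 + \<epsilon>)))"
      using \<open>real d > 0\<close> by (simp add: power2_eq_square powr_add[symmetric])
    also have "\<dots> = 4 * real d powr (2 * \<epsilon>)" unfolding powr_add[symmetric] by simp
    finally have "80 + 16 * ln (100 * real m) \<le> real d * (2 * real d powr (- 1 / 2 + \<epsilon>))\<^sup>2"
      using d0[OF d] by (simp add: L_def)
    then show "\<P>(P in kostlan d. in_different_components {1..m} p (- real_curve d P)) \<ge> real d powr (- (856000 * (real m)\<^sup>2 + 1))"
      using assms d0[OF d] far by (intro kostlan_separation_probability[where t="2 * real d powr (- 1 / 2 + \<epsilon>)"]) auto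
  qed
qed

end
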